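(* Let $G$ be a finite group which is a weak direct product $G=[A]B$ of subgroups $A$ and $B$ (with $A$ normal in $G$). If $A$ and $B$ are $w$-supersoluble, then $G$ is $w$-supersoluble.
   Context: All groups are finite. Two subgroups $X,Y$ of a group permute if $XY=YX$. Let $G=AB$ be a product of subgroups $A$ and $B$. $G$ is a weak normal product of $A$ and $B$ if (a) $A$ is normal in $G$, and (b) $B$ permutes with every maximal subgroup of every Sylow subgroup of $A$ (for all primes). $G$ is a weak direct product of $A$ and $B$, written $G=[A]B$, if $G=AB$ is a weak normal product of $A$ and $B$ with $A$ normal in $G$ and $A\cap B=1$. A subgroup $H$ of a group $G$ is $\mathbb{P}$-subnormal in $G$ if either $H=G$ or there is a chain of subgroups $H=H_0\leqslant H_1\leqslant\cdots\leqslant H_n=G$ such that $|H_i:H_{i-1}|$ is a prime for every $i=1,\dots,n$. A group is $w$-supersoluble (widely supersoluble) if every Sylow subgroup of it is $\mathbb{P}$-subnormal in it. The class of $w$-supersoluble groups is denoted $w\mathfrak{U}$. *)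

theory Defs
  imports "HOL-Algebra.Coset" "HOL-Computational_Algebra.Primes"
begin

text \<open>
  A subgroup \<open>H\<close> of \<open>G\<close>, regarded as a group in its own right, is \<open>G\<lparr>carrier := H\<rparr>\<close>.
\<close>

text \<open>
  The prime \<open>p\<close> need not divide \<open>order G\<close>; if it does not, the trivial subgroup is the
  only Sylow \<open>p\<close>-subgroup.
\<close>

definition sylow_subgroup :: "nat \<Rightarrow> 'a set \<Rightarrow> ('a, 'b) monoid_scheme \<Rightarrow> bool" where
  "sylow_subgroup p P G \<longleftrightarrow>
     prime p \<and> subgroup P G \<and> card P = p ^ multiplicity p (order G)"

definition maximal_subgroup :: "'a set \<Rightarrow> ('a, 'b) monoid_scheme \<Rightarrow> bool" where
  "maximal_subgroup M G \<longleftrightarrow>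
     subgroup M G \<and> M \<noteq> carrier G \<and>
     (\<forall>K. subgroup K G \<and> M \<subseteq> K \<longrightarrow> K = M \<or> K = carrier G)"

definition subgroup_index :: "('a, 'b) monoid_scheme \<Rightarrow> 'a set \<Rightarrow> 'a set \<Rightarrow> nat" where
  "subgroup_index G K H = card (rcosets\<^bsub>G\<lparr>carrier := K\<rparr>\<^esub> H)"

definition permuting :: "('a, 'b) monoid_scheme \<Rightarrow> 'a set \<Rightarrow> 'a set \<Rightarrow> bool" where
  "permuting G X Y \<longleftrightarrow> X <#>\<^bsub>G\<^esub> Y = Y <#>\<^bsub>G\<^esub> X"

definition P_subnormal :: "'a set \<Rightarrow> ('a, 'b) monoid_scheme \<Rightarrow> bool" where
  "P_subnormal H G \<longleftrightarrow> subgroup H G \<and>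
     (H = carrier G \<or>
      (\<exists>(n::nat) C. C 0 = H \<and> C n = carrier G \<and>
         (\<forall>i\<le>n. subgroup (C i) G) \<and>
         (\<forall>i\<in>{1..n}. C (i - 1) \<subseteq> C i \<and> prime (subgroup_index G (C i) (C (i - 1))))))"

definition w_supersoluble :: "('a, 'b) monoid_scheme \<Rightarrow> bool" where
  "w_supersoluble G \<longleftrightarrow> group G \<and> finite (carrier G) \<and>
     (\<forall>p P. sylow_subgroup p P G \<longrightarrow> P_subnormal P G)"

definition weak_normal_product ::
  "('a, 'b) monoid_scheme \<Rightarrow> 'a set \<Rightarrow> 'a set \<Rightarrow> bool" where
  "weak_normal_product G A B \<longleftrightarrow>
     subgroup A G \<and> subgroup B G \<and> carrier G = A <#>\<^bsub>G\<^esub> B \<and>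
     A \<lhd> G \<and>
     (\<forall>p P M. sylow_subgroup p P (G\<lparr>carrier := A\<rparr>) \<and> maximal_subgroup M (G\<lparr>carrier := P\<rparr>)
        \<longrightarrow> permuting G B M)"

definition weak_direct_product ::
  "('a, 'b) monoid_scheme \<Rightarrow> 'a set \<Rightarrow> 'a set \<Rightarrow> bool" where
  "weak_direct_product G A B \<longleftrightarrow> weak_normal_product G A B \<and> A \<inter> B = {\<one>\<^bsub>G\<^esub>}"

end

theory Submission
  imports Defs "HOL-Algebra.Sylow" "HOL-Algebra.Multiplicative_Group" "HOL-Number_Theory.Residues" "HOL-Computational_Algebra.Polynomial"
begin

text \<open>
  Because \<open>A\<close> is normal and \<open>A \<inter> B = 1\<close>, a maximal subgroup \<open>M\<close> of a Sylow subgroup of \<open>A\<close> that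
  permutes with \<open>B\<close> is normalized by \<open>B\<close>: from \<open>b m = m' b'\<close> follows
  \<open>b' b\<^sup>-\<^sup>1 \<in> A \<inter> B\<close>, so \<open>b m b\<^sup>-\<^sup>1 = m'\<close>.  Up to conjugacy a Sylow
  \<open>q\<close>-subgroup of \<open>G\<close> is \<open>Q = P B\<^sub>q\<close> with \<open>P = Q \<inter> A\<close> Sylow in \<open>A\<close> and \<open>B\<^sub>q\<close> Sylow in \<open>B\<close>.
  Multiplying a chain from \<open>B\<^sub>q\<close> to \<open>B\<close> by \<open>A\<close> leads from \<open>A Q\<close> to \<open>G\<close>, so the work is to
  reach \<open>A Q\<close> from \<open>Q\<close> (\<open>prime_chain_to_product\<close>).
  
  A \<open>w\<close>-supersoluble group has a Sylow tower: for every \<open>t\<close> the primes \<open>\<ge> t\<close> belong to a normal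
  Hall subgroup \<open>L\<^sub>t\<close> (\<open>upper_hall_step\<close>).  One climbs from \<open>Q\<close> to \<open>A Q\<close> through the groups
  \<open>L\<^sub>t Q\<close>, with \<open>t\<close> decreasing.  Nothing happens at \<open>t = q\<close>.  For a prime \<open>t \<noteq> q\<close> put
  \<open>N = L\<^sub>t\<^sub>+\<^sub>1\<close> and \<open>L = L\<^sub>t\<close>; the \<open>q\<close>-group \<open>Q\<close> acts on the \<open>t\<close>-group \<open>L / N\<close>, and a
  \<open>Q\<close>-invariant series with factors of order \<open>t\<close> is needed.  It exists as soon as \<open>Q\<close> acts through
  an abelian group of exponent dividing \<open>t - 1\<close>: the induced operators on the homomorphisms
  \<open>L \<rightarrow> \<int>/t\<close> then commute and are annihilated by \<open>X\<^sup>t\<^sup>-\<^sup>1 - 1\<close>, which has \<open>t - 1\<close> distinct roots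
  modulo \<open>t\<close>, so they have a common eigenvector; its kernel is the next term of the series
  (\<open>prime_chain_of_commuting_action\<close>).
  
  That \<open>Q\<close> acts in this way has two sources.  Intersecting a chain of prime index from \<open>P\<close> to \<open>A\<close>
  with \<open>L\<close> gives a \<open>P\<close>-invariant series of \<open>L / N\<close> whose factors have order \<open>t\<close>, and on each of
  these \<open>P\<close> acts by scalars (\<open>sylow_commutators_trivial\<close>).  The group \<open>B\<^sub>q\<close> normalizes the kernel
  of every homomorphism \<open>L \<rightarrow> \<int>/t\<close> and hence multiplies all of them by one and the same scalar,
  which commutes with everything (\<open>eigen_of_normalizes_maximal\<close>, \<open>uniform_eigenvalue\<close>).  In both
  cases commutators and \<open>(t - 1)\<close>-th powers act trivially on sections of \<open>L / N\<close>, and the action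
  being coprime they act trivially on \<open>L / N\<close> (\<open>fixed_coset_lift\<close>).
  
  Quotient groups would change the element type, so everything that is said about \<open>L / N\<close> is
  expressed inside \<open>G\<close>, modulo \<open>N\<close>.
\<close>

section \<open>Conjugation and products of subgroups\<close>

lemma card_constant_fibres:
  assumes "finite A" and "\<And>y. y \<in> f ` A \<Longrightarrow> card {x \<in> A. f x = y} = c"
  shows "card A = card (f ` A) * c"
proof -
  have "card A = (\<Sum>x\<in>A. 1)" by simp
  also have "\<dots> = (\<Sum>y\<in>f ` A. card {x \<in> A. f x = y})"
    using sum.image_gen[OF assms(1), of "\<lambda>_. 1::nat" f] by simp
  also have "\<dots> = card (f ` A) * c" using assms(2) by simp
  finally show ?thesis .
qed

locale finite_group = group +
  assumes fin: "finite (carrier G)"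
begin

definition conj_by :: "'a \<Rightarrow> 'a \<Rightarrow> 'a" where
  "conj_by x g = x \<otimes> g \<otimes> inv x"

text \<open>
  Only the inclusion is required; as all subgroups are finite it forces equality
  (\<open>conj_by_image_eq\<close>).
\<close>

definition normalizes :: "'a set \<Rightarrow> 'a set \<Rightarrow> bool" where
  "normalizes X H \<longleftrightarrow> (\<forall>x\<in>X. \<forall>h\<in>H. conj_by x h \<in> H)"

lemma normalizesD: "normalizes X H \<Longrightarrow> x \<in> X \<Longrightarrow> h \<in> H \<Longrightarrow> conj_by x h \<in> H"
  by (simp add: normalizes_def)

lemma sub_carrier: "subgroup H G \<Longrightarrow> x \<in> H \<Longrightarrow> x \<in> carrier G"
  by (rule subgroup.mem_carrier)

lemma sub_finite: "subgroup H G \<Longrightarrow> finite H"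
  using fin finite_subset subgroup.subset by blast

lemma card_pos: "subgroup H G \<Longrightarrow> card H > 0"
  using sub_finite subgroup.one_closed card_gt_0_iff by blast

lemma conj_by_closed [simp]: "x \<in> carrier G \<Longrightarrow> g \<in> carrier G \<Longrightarrow> conj_by x g \<in> carrier G"
  by (simp add: conj_by_def)

lemma inv_cancel [simp]: "x \<in> carrier G \<Longrightarrow> g \<in> carrier G \<Longrightarrow> inv x \<otimes> (x \<otimes> g) = g"
  by (simp add: m_assoc[symmetric])

lemma inv_cancel' [simp]: "x \<in> carrier G \<Longrightarrow> g \<in> carrier G \<Longrightarrow> x \<otimes> (inv x \<otimes> g) = g"
  by (simp add: m_assoc[symmetric])

lemma conj_by_mult: "x \<in> carrier G \<Longrightarrow> g \<in> carrier G \<Longrightarrow> h \<in> carrier G \<Longrightarrow>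
    conj_by x (g \<otimes> h) = conj_by x g \<otimes> conj_by x h"
  by (simp add: conj_by_def m_assoc)

lemma conj_by_cj: "x \<in> carrier G \<Longrightarrow> y \<in> carrier G \<Longrightarrow> g \<in> carrier G \<Longrightarrow>
    conj_by x (conj_by y g) = conj_by (x \<otimes> y) g"
  by (simp add: conj_by_def m_assoc inv_mult_group)

lemma conj_by_one_left [simp]: "g \<in> carrier G \<Longrightarrow> conj_by \<one> g = g"
  by (simp add: conj_by_def)

lemma conj_by_one_right [simp]: "x \<in> carrier G \<Longrightarrow> conj_by x \<one> = \<one>"
  by (simp add: conj_by_def)

lemma conj_by_inv: "x \<in> carrier G \<Longrightarrow> g \<in> carrier G \<Longrightarrow> conj_by x (inv g) = inv (conj_by x g)"
  by (simp add: conj_by_def m_assoc inv_mult_group)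

lemma conj_by_inv_cancel [simp]: "x \<in> carrier G \<Longrightarrow> g \<in> carrier G \<Longrightarrow> conj_by (inv x) (conj_by x g) = g"
  by (simp add: conj_by_cj)

lemma conj_by_inv_cancel' [simp]: "x \<in> carrier G \<Longrightarrow> g \<in> carrier G \<Longrightarrow> conj_by x (conj_by (inv x) g) = g"
  by (simp add: conj_by_cj)

lemma conj_by_inj: "x \<in> carrier G \<Longrightarrow> H \<subseteq> carrier G \<Longrightarrow> inj_on (conj_by x) H"
  by (metis (no_types, lifting) conj_by_inv_cancel in_mono inj_on_inverseI)

lemma conj_by_pow: "x \<in> carrier G \<Longrightarrow> g \<in> carrier G \<Longrightarrow> conj_by (x [^] (n::nat)) g = (conj_by x ^^ n) g"
proof (induction n arbitrary: g)
  case (Suc n)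
  have "conj_by (x [^] Suc n) g = conj_by (x [^] n) (conj_by x g)" using Suc.prems by (simp add: conj_by_cj)
  also have "\<dots> = (conj_by x ^^ Suc n) g" using Suc by (simp add: funpow_swap1)
  finally show ?case .
qed simp

lemma conj_by_image_eq:
  assumes "x \<in> carrier G" "subgroup H G" "\<And>h. h \<in> H \<Longrightarrow> conj_by x h \<in> H"
  shows "conj_by x ` H = H"
proof (rule card_subset_eq)
  show "finite H" using sub_finite assms by blast
  show "conj_by x ` H \<subseteq> H" using assms by blast
  show "card (conj_by x ` H) = card H"
    using conj_by_inj assms subgroup.subset card_image by metis
qed

lemma conj_by_subgroup:
  assumes "x \<in> carrier G" "subgroup H G"
  shows "subgroup (conj_by x ` H) G"
proof (rule subgroupI)
  show "conj_by x ` H \<subseteq> carrier G" using assms sub_carrier by auto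
  show "conj_by x ` H \<noteq> {}" using assms subgroup.one_closed by blast
  show "inv a \<in> conj_by x ` H" if a: "a \<in> conj_by x ` H" for a
  proof -
    obtain h where "h \<in> H" "a = conj_by x h" using a by blast
    then have "inv a = conj_by x (inv h)" "inv h \<in> H"
      using assms by (auto simp: conj_by_inv sub_carrier subgroup.m_inv_closed)
    then show ?thesis by blast
  qed
  show "a \<otimes> b \<in> conj_by x ` H" if ab: "a \<in> conj_by x ` H" "b \<in> conj_by x ` H" for a b
  proof -
    obtain h k where "h \<in> H" "k \<in> H" "a = conj_by x h" "b = conj_by x k" using ab by blast
    then have "a \<otimes> b = conj_by x (h \<otimes> k)" "h \<otimes> k \<in> H"
      using assms by (auto simp: conj_by_mult sub_carrier subgroup.m_closed)
    then show ?thesis by blast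
  qed
qed

lemma card_conj_by: "x \<in> carrier G \<Longrightarrow> subgroup H G \<Longrightarrow> card (conj_by x ` H) = card H"
  using conj_by_inj subgroup.subset card_image by metis

lemma conj_by_mem_iff:
  assumes "x \<in> carrier G" "subgroup H G" "normalizes {x} H" "g \<in> carrier G"
  shows "conj_by x g \<in> H \<longleftrightarrow> g \<in> H"
proof
  assume "conj_by x g \<in> H"
  moreover have "conj_by x ` H = H" using conj_by_image_eq assms by (simp add: normalizes_def)
  ultimately obtain h where h: "h \<in> H" "conj_by x h = conj_by x g" by (metis imageE)
  have "g = conj_by (inv x) (conj_by x h)" unfolding h(2) using assms by simp
  also have "\<dots> = h" using h(1) assms(1,2) sub_carrier by simp
  finally show "g \<in> H" using h(1) by simp
qed (use assms in \<open>simp add: normalizes_def\<close>)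

lemma normalizes_inv:
  assumes "x \<in> carrier G" "subgroup H G" "normalizes {x} H" "h \<in> H"
  shows "conj_by (inv x) h \<in> H"
  using conj_by_mem_iff[OF assms(1-3), of "conj_by (inv x) h"] assms sub_carrier by simp

lemma normalizes_self: "subgroup H G \<Longrightarrow> normalizes H H"
  by (simp add: normalizes_def conj_by_def subgroup.m_closed subgroup.m_inv_closed)

lemma normalizes_mono: "normalizes X H \<Longrightarrow> Y \<subseteq> X \<Longrightarrow> normalizes Y H"
  by (auto simp: normalizes_def)

lemma normalizes_Int: "normalizes X H \<Longrightarrow> normalizes X K \<Longrightarrow> normalizes X (H \<inter> K)"
  by (auto simp: normalizes_def)

lemma mem_set_multI: "h \<in> H \<Longrightarrow> k \<in> K \<Longrightarrow> h \<otimes> k \<in> H <#> K"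
  by (auto simp: set_mult_def)

lemma set_mult_normalizes:
  assumes "subgroup H G" "subgroup K G" "subgroup N G" "normalizes H N" "normalizes K N"
  shows "normalizes (H <#> K) N"
  unfolding normalizes_def set_mult_def
proof (clarsimp)
  fix h k n assume a: "h \<in> H" "k \<in> K" "n \<in> N"
  then have "conj_by (h \<otimes> k) n = conj_by h (conj_by k n)" using assms by (simp add: conj_by_cj sub_carrier)
  then show "conj_by (h \<otimes> k) n \<in> N" using a assms by (simp add: normalizesD)
qed

lemma subgroup_set_mult:
  assumes N: "subgroup N G" and H: "subgroup H G" and nrm: "normalizes H N"
  shows "subgroup (N <#> H) G"
proof (rule subgroupI)
  show "N <#> H \<subseteq> carrier G" using setmult_subset_G N H subgroup.subset by metis
  show "N <#> H \<noteq> {}" using N H subgroup.one_closed unfolding set_mult_def by blast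
next
  fix a assume "a \<in> N <#> H"
  then obtain n h where a: "n \<in> N" "h \<in> H" "a = n \<otimes> h" unfolding set_mult_def by blast
  have c: "n \<in> carrier G" "h \<in> carrier G" using a sub_carrier[OF N] sub_carrier[OF H] by blast+
  have "inv a = conj_by (inv h) (inv n) \<otimes> inv h" using c a by (simp add: conj_by_def inv_mult_group m_assoc)
  moreover have "conj_by (inv h) (inv n) \<in> N"
    using a N H nrm by (metis normalizesD subgroup.m_inv_closed)
  ultimately show "inv a \<in> N <#> H" using a H by (simp add: mem_set_multI subgroup.m_inv_closed)
next
  fix a b assume "a \<in> N <#> H" "b \<in> N <#> H"
  then obtain n h m k where a: "n \<in> N" "h \<in> H" "a = n \<otimes> h" "m \<in> N" "k \<in> H" "b = m \<otimes> k"
    unfolding set_mult_def by blast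
  have c: "n \<in> carrier G" "h \<in> carrier G" "m \<in> carrier G" "k \<in> carrier G"
    using a sub_carrier[OF N] sub_carrier[OF H] by blast+
  have "a \<otimes> b = (n \<otimes> conj_by h m) \<otimes> (h \<otimes> k)"
  proof -
    have "inv h \<otimes> (h \<otimes> k) = k" using c by simp
    then show ?thesis using c a by (simp add: conj_by_def m_assoc)
  qed
  moreover have "n \<otimes> conj_by h m \<in> N" "h \<otimes> k \<in> H"
    using a N H nrm by (simp_all add: normalizesD subgroup.m_closed)
  ultimately show "a \<otimes> b \<in> N <#> H" by (simp add: mem_set_multI)
qed

lemma set_mult_upper1: "subgroup H G \<Longrightarrow> N \<subseteq> carrier G \<Longrightarrow> N \<subseteq> N <#> H"
  unfolding set_mult_def using subgroup.one_closed by (fastforce intro!: bexI[of _ "\<one>"])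

lemma set_mult_upper2: "subgroup N G \<Longrightarrow> H \<subseteq> carrier G \<Longrightarrow> H \<subseteq> N <#> H"
  unfolding set_mult_def using subgroup.one_closed by (fastforce intro!: bexI[of _ "\<one>"])

lemma set_mult_least:
  "subgroup K G \<Longrightarrow> N \<subseteq> K \<Longrightarrow> H \<subseteq> K \<Longrightarrow> N <#> H \<subseteq> K"
  by (auto simp: set_mult_def subset_iff intro: subgroup.m_closed)

text \<open>
  The product map \<open>H \<times> K \<rightarrow> H K\<close> has the fibres \<open>{(h d, d\<^sup>-\<^sup>1 k) | d \<in> H \<inter> K}\<close>.  In what
  follows this formula replaces the index computations that are usually done in quotients.
\<close>

lemma card_set_mult:
  assumes H: "subgroup H G" and K: "subgroup K G"
  shows "card (H <#> K) * card (H \<inter> K) = card H * card K"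
proof -
  let ?f = "\<lambda>(h, k). h \<otimes> k"
  have im: "?f ` (H \<times> K) = H <#> K" by (auto simp: set_mult_def)
  have fibre: "card {x \<in> H \<times> K. ?f x = y} = card (H \<inter> K)" if y: "y \<in> ?f ` (H \<times> K)" for y
  proof -
    obtain h k where hk: "h \<in> H" "k \<in> K" "y = h \<otimes> k" using y by auto
    have c: "h \<in> carrier G" "k \<in> carrier G" using hk sub_carrier[OF K] sub_carrier[OF H] by blast+
    have 1: "(\<lambda>d. (h \<otimes> d, inv d \<otimes> k)) \<in> H \<inter> K \<rightarrow> {x \<in> H \<times> K. ?f x = y}"
    proof
      fix d assume d: "d \<in> H \<inter> K"
      then have dc: "d \<in> carrier G" using sub_carrier[OF H] by blast
      have "d \<otimes> (inv d \<otimes> k) = k" using dc c by simp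
      then have "h \<otimes> d \<otimes> (inv d \<otimes> k) = y" using dc c hk by (simp add: m_assoc)
      then show "(h \<otimes> d, inv d \<otimes> k) \<in> {x \<in> H \<times> K. ?f x = y}"
        using d hk H K by (auto intro: subgroup.m_closed subgroup.m_inv_closed)
    qed
    have 2: "(\<lambda>x. inv h \<otimes> fst x) \<in> {x \<in> H \<times> K. ?f x = y} \<rightarrow> H \<inter> K"
    proof
      fix x assume x: "x \<in> {x \<in> H \<times> K. ?f x = y}"
      then obtain h' k' where a: "x = (h', k')" "h' \<in> H" "k' \<in> K" "h' \<otimes> k' = y" by auto
      have c': "h' \<in> carrier G" "k' \<in> carrier G" using a sub_carrier[OF K] sub_carrier[OF H] by blast+
      have e: "h \<otimes> k = h' \<otimes> k'" using a hk by simp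
      have "inv h \<otimes> h' = inv h \<otimes> (h' \<otimes> k') \<otimes> inv k'" using c c' by (simp add: m_assoc)
      also have "\<dots> = k \<otimes> inv k'" unfolding e[symmetric] using c c' by simp
      finally have "inv h \<otimes> h' = k \<otimes> inv k'" .
      moreover have "inv h \<otimes> h' \<in> H" "k \<otimes> inv k' \<in> K"
        using a hk H K by (simp_all add: subgroup.m_closed subgroup.m_inv_closed)
      ultimately show "inv h \<otimes> fst x \<in> H \<inter> K" using a by simp
    qed
    have 3: "inv h \<otimes> fst (h \<otimes> d, inv d \<otimes> k) = d" if "d \<in> H \<inter> K" for d
      using that c sub_carrier[OF H] by simp
    have 4: "(h \<otimes> (inv h \<otimes> fst x), inv (inv h \<otimes> fst x) \<otimes> k) = x"
      if x: "x \<in> {x \<in> H \<times> K. ?f x = y}" for x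
    proof -
      obtain h' k' where a: "x = (h', k')" "h' \<in> H" "k' \<in> K" "h' \<otimes> k' = y" using x by auto
      have c': "h' \<in> carrier G" "k' \<in> carrier G" using a sub_carrier[OF K] sub_carrier[OF H] by blast+
      have e: "h \<otimes> k = h' \<otimes> k'" using a hk by simp
      have "h \<otimes> (inv h \<otimes> h') = h'" using c c' by simp
      moreover have "inv (inv h \<otimes> h') \<otimes> k = k'"
      proof -
        have "inv (inv h \<otimes> h') \<otimes> k = inv h' \<otimes> (h \<otimes> k)" using c c' by (simp add: inv_mult_group m_assoc)
        also have "\<dots> = k'" unfolding e using c' by simp
        finally show ?thesis .
      qed
      ultimately show ?thesis using a by simp
    qed
    have "bij_betw (\<lambda>d. (h \<otimes> d, inv d \<otimes> k)) (H \<inter> K) {x \<in> H \<times> K. ?f x = y}"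
      by (rule bij_betwI[OF 1 2 3 4])
    then show ?thesis using bij_betw_same_card by fastforce
  qed
  have "card (H \<times> K) = card (H <#> K) * card (H \<inter> K)"
    using card_constant_fibres[of "H \<times> K" ?f "card (H \<inter> K)"] fibre im sub_finite H K by auto
  then show ?thesis by (simp add: card_cartesian_product)
qed

lemma card_dvd:
  assumes "subgroup H G" "subgroup K G" "H \<subseteq> K" shows "card H dvd card K"
proof -
  interpret K: group "G\<lparr>carrier := K\<rparr>" using assms(2) by (rule subgroup_imp_group)
  have "card (rcosets\<^bsub>G\<lparr>carrier := K\<rparr>\<^esub> H) * card H = Coset.order (G\<lparr>carrier := K\<rparr>)"
    using K.lagrange subgroup_incl assms by blast
  then show ?thesis by (simp add: Coset.order_def) (metis dvd_triv_right)
qed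

lemma subgroup_Int: "subgroup H G \<Longrightarrow> subgroup K G \<Longrightarrow> subgroup (H \<inter> K) G"
  by (rule subgroups_Inter_pair)

lemma pow_mem: "subgroup H G \<Longrightarrow> x \<in> H \<Longrightarrow> x [^] (n::nat) \<in> H"
  by (induction n) (auto simp: subgroup.one_closed subgroup.m_closed)

lemma pow_card_eq_one:
  assumes "subgroup H G" "x \<in> H" shows "x [^] card H = \<one>"
proof -
  interpret H: group "G\<lparr>carrier := H\<rparr>" using assms(1) by (rule subgroup_imp_group)
  have "x [^]\<^bsub>G\<lparr>carrier := H\<rparr>\<^esub> Coset.order (G\<lparr>carrier := H\<rparr>) = \<one>\<^bsub>G\<lparr>carrier := H\<rparr>\<^esub>"
    using H.pow_order_eq_1 assms by simp
  then show ?thesis by (simp add: Coset.order_def flip: nat_pow_consistent)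
qed

end

section \<open>Common eigenfunctions modulo a prime\<close>

text \<open>
  The value \<open>p(\<sigma>\<^sup>*) f\<close> of the polynomial \<open>p\<close> at the operator \<open>\<sigma>\<^sup>* : f \<mapsto> f \<circ> \<sigma>\<close>, applied to
  \<open>f\<close>.  Homomorphisms into \<open>\<int>/t\<close> are handled as integer valued functions that are compared modulo
  \<open>t\<close>, which allows the use of integer polynomials.
\<close>

definition poly_shift :: "('a \<Rightarrow> 'a) \<Rightarrow> int poly \<Rightarrow> ('a \<Rightarrow> int) \<Rightarrow> 'a \<Rightarrow> int" where
  "poly_shift \<sigma> p f g = (\<Sum>i\<le>degree p. coeff p i * f ((\<sigma> ^^ i) g))"

lemma poly_shift_pCons:
  "poly_shift \<sigma> (pCons a p) f g = a * f g + poly_shift \<sigma> p f (\<sigma> g)"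
proof (cases "p = 0")
  case True
  then show ?thesis by (cases "a = 0") (simp_all add: poly_shift_def)
next
  case False
  then have "poly_shift \<sigma> (pCons a p) f g =
      (\<Sum>i\<le>Suc (degree p). coeff (pCons a p) i * f ((\<sigma> ^^ i) g))"
    by (simp add: poly_shift_def)
  also have "\<dots> = a * f g + (\<Sum>i\<le>degree p. coeff p i * f ((\<sigma> ^^ i) (\<sigma> g)))"
    by (simp add: sum.atMost_Suc_shift funpow_swap1 del: sum.atMost_Suc)
  finally show ?thesis by (simp add: poly_shift_def)
qed

lemma poly_shift_0 [simp]: "poly_shift \<sigma> 0 f g = 0"
  by (simp add: poly_shift_def)

text \<open>
  Division with remainder, \<open>p = (X - k) q + p(k)\<close>, evaluated at the operator.
\<close>

lemma poly_shift_synthetic_div: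
  "poly_shift \<sigma> p f g =
     poly_shift \<sigma> (synthetic_div p k) (\<lambda>h. f (\<sigma> h) - k * f h) g + poly p k * f g"
proof (induction p arbitrary: g)
  case (pCons a p)
  show ?case
    unfolding synthetic_div_pCons poly_shift_pCons pCons.IH[of "\<sigma> g"] poly_pCons
    by (simp add: algebra_simps)
qed simp

text \<open>
  A polynomial with as many roots modulo \<open>t\<close> as its degree annihilates \<open>f\<close>; splitting off one root
  \<open>k\<close> after the other, either \<open>(\<sigma>\<^sup>* - k) f\<close> vanishes and \<open>f\<close> is an eigenfunction, or it is a new
  nonzero function annihilated by the quotient polynomial.  The predicate \<open>F\<close> stands for the
  invariant space in which the eigenfunction is to be found.
\<close>

lemma eigenfunction_from_roots:
  fixes t :: nat and X :: "'a set"
  assumes t: "prime t"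
    and closed: "\<And>f k. F f \<Longrightarrow> F (\<lambda>g. f (\<sigma> g) - k * f g)"
  shows "degree p = d \<Longrightarrow> lead_coeff p = 1 \<Longrightarrow> R \<subseteq> {1..<int t} \<Longrightarrow> card R = d \<Longrightarrow>
    (\<And>k. k \<in> R \<Longrightarrow> int t dvd poly p k) \<Longrightarrow> F f \<Longrightarrow> \<exists>g\<in>X. \<not> int t dvd f g \<Longrightarrow>
    (\<And>g. g \<in> X \<Longrightarrow> int t dvd poly_shift \<sigma> p f g) \<Longrightarrow>
    \<exists>w k. F w \<and> (\<exists>g\<in>X. \<not> int t dvd w g) \<and> (\<forall>g\<in>X. [w (\<sigma> g) = k * w g] (mod int t))"
proof (induction d arbitrary: p R f)
  case 0
  then obtain c where "p = [:c:]" using degree_eq_zeroE by blast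
  then have "p = 1" using 0 by (simp add: one_pCons)
  then show ?case using 0 by (simp add: poly_shift_def)
next
  case (Suc d)
  have "R \<noteq> {}" using Suc.prems by auto
  then obtain k where k: "k \<in> R" by blast
  let ?w = "\<lambda>g. f (\<sigma> g) - k * f g"
  show ?case
  proof (cases "\<exists>g\<in>X. \<not> int t dvd ?w g")
    case False
    then have "\<forall>g\<in>X. [f (\<sigma> g) = k * f g] (mod int t)" by (simp add: cong_iff_dvd_diff)
    then show ?thesis using Suc.prems by blast
  next
    case True
    let ?q = "synthetic_div p k"
    have pq: "p + smult k ?q = pCons (poly p k) ?q" by (rule synthetic_div_correct)
    have pj: "poly p j = (j - k) * poly ?q j + poly p k" for j
    proof -
      have "poly (p + smult k ?q) j = poly (pCons (poly p k) ?q) j" unfolding pq ..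
      then show ?thesis by (simp add: algebra_simps)
    qed
    have deg: "degree ?q = d" using Suc.prems by (simp add: degree_synthetic_div)
    have "coeff (p + smult k ?q) (Suc d) = coeff (pCons (poly p k) ?q) (Suc d)" unfolding pq ..
    then have lc: "lead_coeff ?q = 1" using Suc.prems deg by (simp add: coeff_eq_0)
    have fR: "finite R" using Suc.prems(4) card.infinite by fastforce
    show ?thesis
    proof (rule Suc.IH[of ?q "R - {k}" ?w])
      show "degree ?q = d" "lead_coeff ?q = 1" by fact+
      show "R - {k} \<subseteq> {1..<int t}" using Suc.prems by auto
      show "card (R - {k}) = d" using Suc.prems k fR by simp
      show "F ?w" using closed Suc.prems by blast
      show "\<exists>g\<in>X. \<not> int t dvd ?w g" by fact
      show "int t dvd poly ?q j" if j: "j \<in> R - {k}" for j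
      proof -
        have "int t dvd (j - k) * poly ?q j"
          using pj[of j] Suc.prems(5)[of j] Suc.prems(5)[OF k] j by (simp add: dvd_add_left_iff)
        moreover have "\<not> int t dvd j - k"
        proof
          assume "int t dvd j - k"
          moreover have "\<bar>j - k\<bar> < int t" "j - k \<noteq> 0"
            using subsetD[OF Suc.prems(3), of j] subsetD[OF Suc.prems(3), of k] j k by auto
          ultimately show False using dvd_imp_le_int[of "j - k" "int t"] by simp
        qed
        ultimately show ?thesis using t by (meson prime_dvd_multD prime_nat_int_transfer)
      qed
      show "int t dvd poly_shift \<sigma> ?q ?w g" if g: "g \<in> X" for g
      proof -
        have "int t dvd poly_shift \<sigma> p f g" using Suc.prems g by blast
        then have "int t dvd poly_shift \<sigma> ?q ?w g + poly p k * f g"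
          by (subst (asm) poly_shift_synthetic_div[of \<sigma> p f g k])
        then show ?thesis using Suc.prems(5)[OF k] by (simp add: dvd_add_left_iff)
      qed
    qed
  qed
qed

lemma fermat_int:
  assumes "prime (t::nat)" "\<not> int t dvd k"
  shows "[k ^ (t - 1) = 1] (mod int t)"
proof -
  have "residues_prime t" using assms by (simp add: residues_prime_def)
  have p: "prime (int t)" using assms by simp
  have kn: "[int (nat (k mod int t)) = k] (mod int t)"
    using assms prime_gt_0_nat by (simp add: cong_def)
  have "\<not> t dvd nat (k mod int t)"
    using assms kn by (metis cong_dvd_iff int_dvd_int_iff)
  then have "[nat (k mod int t) ^ (t - 1) = 1] (mod t)" by (rule fermat_theorem[OF assms(1)])
  then have "[int (nat (k mod int t) ^ (t - 1)) = int 1] (mod int t)" by (simp only: cong_int_iff)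
  then have "[int (nat (k mod int t)) ^ (t - 1) = 1] (mod int t)" by simp
  moreover have "[int (nat (k mod int t)) ^ (t - 1) = k ^ (t - 1)] (mod int t)"
    using kn by (rule cong_pow)
  ultimately show ?thesis using cong_sym cong_trans by blast
qed

text \<open>
  By Fermat, \<open>X\<^sup>t\<^sup>-\<^sup>1 - 1\<close> has the \<open>t - 1\<close> roots \<open>1, \<dots>, t - 1\<close> modulo \<open>t\<close>.
\<close>

lemma eigenfunction_exists:
  fixes t :: nat and X :: "'a set"
  assumes t: "prime t"
    and closed: "\<And>f k. F f \<Longrightarrow> F (\<lambda>g. f (\<sigma> g) - k * f g)"
    and period: "\<And>f g. F f \<Longrightarrow> g \<in> X \<Longrightarrow> [f ((\<sigma> ^^ (t - 1)) g) = f g] (mod int t)"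
    and f: "F f" "\<exists>g\<in>X. \<not> int t dvd f g"
  shows "\<exists>w k. F w \<and> (\<exists>g\<in>X. \<not> int t dvd w g) \<and> (\<forall>g\<in>X. [w (\<sigma> g) = k * w g] (mod int t))"
proof -
  define m where "m = t - 2"
  have m: "t - 1 = Suc m" using prime_ge_2_nat[OF t] m_def by linarith
  let ?p = "pCons (-1) (monom 1 m) :: int poly"
  have deg: "degree ?p = t - 1" unfolding m by (simp add: degree_monom_eq)
  have mon: "monom 1 m \<noteq> (0 :: int poly)" by simp
  show ?thesis
  proof (rule eigenfunction_from_roots[where F = F and \<sigma> = \<sigma> and f = f and R = "{1..<int t}", OF t closed deg])
    show "lead_coeff ?p = 1" using mon by (simp add: degree_monom_eq)
    show "card {1..<int t} = t - 1" by simp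
    show "int t dvd poly ?p k" if k: "k \<in> {1..<int t}" for k
    proof -
      have "\<not> int t dvd k" using k zdvd_imp_le by fastforce
      then have "[k ^ Suc m = 1] (mod int t)" using fermat_int[OF t] m by simp
      then show ?thesis by (simp add: poly_monom cong_iff_dvd_diff)
    qed
    show "int t dvd poly_shift \<sigma> ?p f g" if g: "g \<in> X" for g
    proof -
      have "poly_shift \<sigma> ?p f g = - f g + poly_shift \<sigma> (monom 1 m) f (\<sigma> g)"
        by (simp add: poly_shift_pCons)
      also have "poly_shift \<sigma> (monom 1 m) f (\<sigma> g) = f ((\<sigma> ^^ m) (\<sigma> g))"
      proof -
        have "poly_shift \<sigma> (monom 1 m) f (\<sigma> g) =
            (\<Sum>i\<le>m. if i = m then f ((\<sigma> ^^ i) (\<sigma> g)) else 0)"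
          unfolding poly_shift_def by (intro sum.cong) (auto simp: degree_monom_eq coeff_monom)
        then show ?thesis by simp
      qed
      also have "(\<sigma> ^^ m) (\<sigma> g) = (\<sigma> ^^ (t - 1)) g" unfolding m by (simp add: funpow_swap1)
      finally show ?thesis using period[OF f(1) g] by (simp add: cong_iff_dvd_diff)
    qed
  qed (use f in auto)
qed

text \<open>
  Commuting operators preserve each other's eigenspaces, so the operators can be diagonalized one
  at a time inside the common eigenspace of the previous ones.
\<close>

lemma common_eigenfunction_exists:
  fixes t :: nat and X :: "'a set"
  assumes t: "prime t" and S: "finite S"
    and closed: "\<And>f k \<sigma>. F f \<Longrightarrow> \<sigma> \<in> S \<Longrightarrow> F (\<lambda>g. f (\<sigma> g) - k * f g)"
    and maps: "\<And>\<sigma> g. \<sigma> \<in> S \<Longrightarrow> g \<in> X \<Longrightarrow> \<sigma> g \<in> X"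
    and period: "\<And>f g \<sigma>. F f \<Longrightarrow> \<sigma> \<in> S \<Longrightarrow> g \<in> X \<Longrightarrow> [f ((\<sigma> ^^ (t - 1)) g) = f g] (mod int t)"
    and comm: "\<And>f g \<sigma> \<tau>. F f \<Longrightarrow> \<sigma> \<in> S \<Longrightarrow> \<tau> \<in> S \<Longrightarrow> g \<in> X \<Longrightarrow>
        [f (\<sigma> (\<tau> g)) = f (\<tau> (\<sigma> g))] (mod int t)"
    and f: "F f" "\<exists>g\<in>X. \<not> int t dvd f g"
  shows "\<exists>w. F w \<and> (\<exists>g\<in>X. \<not> int t dvd w g) \<and>
    (\<forall>\<sigma>\<in>S. \<exists>k. \<forall>g\<in>X. [w (\<sigma> g) = k * w g] (mod int t))"
proof -
  let ?E = "\<lambda>w \<sigma>. \<exists>k. \<forall>g\<in>X. [w (\<sigma> g) = k * w g] (mod int t)"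
  have "T \<subseteq> S \<Longrightarrow> \<exists>w. F w \<and> (\<exists>g\<in>X. \<not> int t dvd w g) \<and> (\<forall>\<sigma>\<in>T. ?E w \<sigma>)" if T: "finite T" for T
    using T
  proof (induction T)
    case empty
    then show ?case using f by blast
  next
    case (insert \<tau> T)
    then obtain w where w: "F w" "\<exists>g\<in>X. \<not> int t dvd w g" "\<forall>\<sigma>\<in>T. ?E w \<sigma>" by auto
    let ?F = "\<lambda>w. F w \<and> (\<forall>\<sigma>\<in>T. ?E w \<sigma>)"
    have \<tau>: "\<tau> \<in> S" using insert.prems by simp
    have cl: "?F (\<lambda>g. v (\<tau> g) - k * v g)" if v: "?F v" for v k
    proof (intro conjI ballI)
      show "F (\<lambda>g. v (\<tau> g) - k * v g)" using v closed \<tau> by blast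
      fix \<sigma> assume \<sigma>: "\<sigma> \<in> T"
      then obtain l where l: "\<And>g. g \<in> X \<Longrightarrow> [v (\<sigma> g) = l * v g] (mod int t)" using v by blast
      have "[v (\<tau> (\<sigma> g)) - k * v (\<sigma> g) = l * (v (\<tau> g) - k * v g)] (mod int t)" if g: "g \<in> X" for g
      proof -
        have "[v (\<tau> (\<sigma> g)) = v (\<sigma> (\<tau> g))] (mod int t)"
          using comm[of v \<tau> \<sigma> g] v \<tau> \<sigma> insert.prems g by auto
        also have "[v (\<sigma> (\<tau> g)) = l * v (\<tau> g)] (mod int t)" using l maps[OF \<tau> g] by blast
        finally have "[v (\<tau> (\<sigma> g)) - k * v (\<sigma> g) = l * v (\<tau> g) - k * (l * v g)] (mod int t)"
          using l[OF g] by (intro cong_diff cong_scalar_left)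
        then show ?thesis by (simp add: algebra_simps)
      qed
      then show "?E (\<lambda>g. v (\<tau> g) - k * v g) \<sigma>" by blast
    qed
    have "\<exists>w k. ?F w \<and> (\<exists>g\<in>X. \<not> int t dvd w g) \<and> (\<forall>g\<in>X. [w (\<tau> g) = k * w g] (mod int t))"
    proof (rule eigenfunction_exists[where F = ?F and \<sigma> = \<tau> and f = w, OF t cl])
      show "?F w" using w by blast
      show "\<exists>g\<in>X. \<not> int t dvd w g" using w by blast
      show "[v ((\<tau> ^^ (t - 1)) g) = v g] (mod int t)" if "?F v" "g \<in> X" for v g
        using that period \<tau> by blast
    qed
    then show ?case by (metis (no_types, lifting) insert_iff)
  qed
  then show ?thesis using S by blast
qed

section \<open>Normal subgroups of prime index\<close>

lemma (in normal) subgroup_over_of_prime_index: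
  assumes f: "finite (carrier G)" and r: "prime r" and d: "r dvd Coset.order (G Mod H)"
  shows "\<exists>K. subgroup K G \<and> H \<subseteq> K \<and> card K = r * card H"
proof -
  interpret Q: group "G Mod H" by (rule factorgroup_is_group)
  have fQ: "finite (carrier (G Mod H))" using f by (simp add: carrier_FactGroup)
  obtain c where "Coset.order (G Mod H) = r ^ 1 * c" using d by auto
  then obtain A where A: "subgroup A (G Mod H)" "card A = r"
    using sylow_thm[OF r Q.is_group _ fQ, of 1 c] by auto
  have sub: "subgroup (\<Union>A) G" using A(1) by (rule factgroup_subgroup_union_subgroup)
  have Ar: "A \<subseteq> rcosets H" using subgroup.subset[OF A(1)] by (simp add: FactGroup_def)
  have HA: "H \<in> A" using subgroup.one_closed[OF A(1)] by simp
  have "card H * card A = card (\<Union>A)"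
  proof (rule card_partition)
    show "finite A" using A(1) fQ subgroup.subset finite_subset by metis
    show "finite (\<Union>A)" using sub f subgroup.subset finite_subset by metis
    show "card C = card H" if "C \<in> A" for C
      using card_cosets_equal[of C H] that Ar subset bij_betw_same_card by fastforce
    show "C \<inter> D = {}" if "C \<in> A" "D \<in> A" "C \<noteq> D" for C D
      using rcos_disjoint[OF subgroup_axioms] that Ar by (auto simp: pairwise_def disjnt_def)
  qed
  then show ?thesis using sub HA A(2) by (intro exI[of _ "\<Union>A"]) (auto simp: mult.commute)
qed

text \<open>
  The quotient is cyclic of prime order; the exponent of a fixed generator is the required
  homomorphism, with an arbitrary integer representative.
\<close>

lemma (in normal) prime_index_character:
  assumes f: "finite (carrier G)" and t: "prime t" and o: "Coset.order (G Mod H) = t"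
  shows "\<exists>f :: 'a \<Rightarrow> int. (\<forall>g\<in>carrier G. \<forall>h\<in>carrier G. [f (g \<otimes> h) = f g + f h] (mod int t)) \<and>
    (\<forall>g\<in>carrier G. int t dvd f g \<longleftrightarrow> g \<in> H)"
proof -
  interpret Q: group "G Mod H" by (rule factorgroup_is_group)
  have fQ: "finite (carrier (G Mod H))" using f by (simp add: carrier_FactGroup)
  have "\<exists>c\<in>carrier (G Mod H). c \<noteq> \<one>\<^bsub>G Mod H\<^esub>"
  proof (rule ccontr)
    assume "\<not> ?thesis"
    then have "carrier (G Mod H) = {\<one>\<^bsub>G Mod H\<^esub>}" using Q.one_closed by blast
    then have "t = 1" using o by (simp add: Coset.order_def)
    then show False using t by simp
  qed
  then obtain c where c: "c \<in> carrier (G Mod H)" "c \<noteq> \<one>\<^bsub>G Mod H\<^esub>" by blast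
  have oc: "Q.ord c = t"
    using Q.ord_dvd_group_order[OF c(1)] Q.ord_eq_1[OF c(1)] c(2) t o
    by (metis prime_nat_iff)
  have pows: "(\<lambda>i::nat. c [^]\<^bsub>G Mod H\<^esub> i) ` {0..t - 1} = carrier (G Mod H)"
  proof (rule card_subset_eq[OF fQ])
    show "(\<lambda>i::nat. c [^]\<^bsub>G Mod H\<^esub> i) ` {0..t - 1} \<subseteq> carrier (G Mod H)" using c by auto
    have "inj_on (\<lambda>i::nat. c [^]\<^bsub>G Mod H\<^esub> i) {0..t - 1}" using Q.ord_inj[OF c(1)] oc by simp
    then show "card ((\<lambda>i::nat. c [^]\<^bsub>G Mod H\<^esub> i) ` {0..t - 1}) = card (carrier (G Mod H))"
      using o t prime_gt_0_nat by (simp add: card_image Coset.order_def)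
  qed
  define f where "f g = (SOME i::int. H #> g = c [^]\<^bsub>G Mod H\<^esub> i)" for g
  have f: "H #> g = c [^]\<^bsub>G Mod H\<^esub> f g" if "g \<in> carrier G" for g
  proof -
    have "H #> g \<in> carrier (G Mod H)" using that by (simp add: carrier_FactGroup)
    then obtain i :: nat where "H #> g = c [^]\<^bsub>G Mod H\<^esub> i" using pows by (metis imageE)
    then have "H #> g = c [^]\<^bsub>G Mod H\<^esub> int i" by (simp add: int_pow_int)
    then show ?thesis unfolding f_def by (rule someI)
  qed
  have "[f (g \<otimes> h) = f g + f h] (mod int t)" if "g \<in> carrier G" "h \<in> carrier G" for g h
  proof -
    have "c [^]\<^bsub>G Mod H\<^esub> f (g \<otimes> h) = c [^]\<^bsub>G Mod H\<^esub> (f g + f h)"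
      using that f[of g] f[of h] f[of "g \<otimes> h"] rcos_sum[of g h] Q.int_pow_mult[OF c(1), of "f g" "f h"]
      by simp
    then have "int t dvd (f g + f h) - f (g \<otimes> h)" using Q.int_pow_eq[OF c(1)] oc by simp
    then show ?thesis by (metis cong_iff_dvd_diff cong_sym)
  qed
  moreover have "int t dvd f g \<longleftrightarrow> g \<in> H" if g: "g \<in> carrier G" for g
  proof -
    have "int t dvd f g \<longleftrightarrow> c [^]\<^bsub>G Mod H\<^esub> f g = \<one>\<^bsub>G Mod H\<^esub>" using Q.int_pow_eq_id[OF c(1)] oc by simp
    also have "\<dots> \<longleftrightarrow> H #> g = H" using f[OF g] by simp
    also have "\<dots> \<longleftrightarrow> g \<in> H" using coset_join1 coset_join2 g subgroup_axioms by blast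
    finally show ?thesis .
  qed
  ultimately show ?thesis by blast
qed

context finite_group
begin

text \<open>
  Orbits of an \<open>r\<close>-group have \<open>r\<close>-power length, hence a length divisible by \<open>r\<close> unless they
  are fixed points.  Only \<open>U / N\<close> has to be an \<open>r\<close>-group, as \<open>N\<close> acts trivially; this is what makes
  the result applicable to sections.
\<close>

lemma card_fixed_points_cong:
  fixes act :: "'a \<Rightarrow> 'x \<Rightarrow> 'x"
  assumes U: "subgroup U G" and N: "subgroup N G" "N \<subseteq> U" and r: "prime r"
    and cU: "card U = r ^ m * card N"
    and X: "finite X" and act: "\<And>u x. u \<in> U \<Longrightarrow> x \<in> X \<Longrightarrow> act u x \<in> X"
    and act_one: "\<And>x. x \<in> X \<Longrightarrow> act \<one> x = x"
    and act_mult: "\<And>u v x. u \<in> U \<Longrightarrow> v \<in> U \<Longrightarrow> x \<in> X \<Longrightarrow> act (u \<otimes> v) x = act u (act v x)"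
    and act_N: "\<And>u x. u \<in> N \<Longrightarrow> x \<in> X \<Longrightarrow> act u x = x"
  shows "[card {x \<in> X. \<forall>u\<in>U. act u x = x} = card X] (mod r)"
proof -
  define orb where "orb x = (\<lambda>u. act u x) ` U" for x
  define F where "F = {x \<in> X. \<forall>u\<in>U. act u x = x}"
  have self: "x \<in> orb x" if "x \<in> X" for x
    using that act_one subgroup.one_closed[OF U] unfolding orb_def by force
  have orb_sub: "orb x \<subseteq> X" if "x \<in> X" for x using that act by (auto simp: orb_def)
  have inv_act: "act (inv u) (act u x) = x" if "u \<in> U" "x \<in> X" for u x
    using that act_mult[of "inv u" u x] act_one U sub_carrier
    by (simp add: subgroup.m_inv_closed)
  have orb_eq: "orb y = orb x" if x: "x \<in> X" and y: "y \<in> orb x" for x y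
  proof -
    obtain u where u: "u \<in> U" "y = act u x" using y by (auto simp: orb_def)
    have "act v y \<in> orb x" if v: "v \<in> U" for v
    proof -
      have "act v y = act (v \<otimes> u) x" using act_mult[OF v u(1) x] u(2) by simp
      then show ?thesis using subgroup.m_closed[OF U v u(1)] by (auto simp: orb_def)
    qed
    moreover have "act v x \<in> orb y" if v: "v \<in> U" for v
    proof -
      have iu: "inv u \<in> U" by (rule subgroup.m_inv_closed[OF U u(1)])
      have "act v x = act (v \<otimes> inv u) y"
        using act_mult[OF v iu, of y] inv_act u x act by simp
      then show ?thesis using subgroup.m_closed[OF U v iu] by (auto simp: orb_def)
    qed
    ultimately show ?thesis unfolding orb_def by blast
  qed
  have orb_dvd: "r dvd card (orb x)" if x: "x \<in> X - F" for x
  proof -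
    define S where "S = {u \<in> U. act u x = x}"
    have xX: "x \<in> X" using x by simp
    have S: "subgroup S G"
    proof (rule subgroupI)
      show "S \<subseteq> carrier G" using U subgroup.subset by (auto simp: S_def)
      show "S \<noteq> {}" using act_one[OF xX] subgroup.one_closed[OF U] by (auto simp: S_def)
      show "inv a \<in> S" if "a \<in> S" for a
        using that inv_act[of a x] xX U by (auto simp: S_def subgroup.m_inv_closed)
      show "a \<otimes> b \<in> S" if "a \<in> S" "b \<in> S" for a b
        using that act_mult[of a b x] xX U by (auto simp: S_def subgroup.m_closed)
    qed
    have NS: "N \<subseteq> S" using N act_N xX by (auto simp: S_def)
    have "card U = card (orb x) * card S"
      unfolding orb_def
    proof (rule card_constant_fibres)
      show "finite U" using U by (rule sub_finite)
      fix y assume "y \<in> (\<lambda>u. act u x) ` U"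
      then obtain h where h: "h \<in> U" "y = act h x" by blast
      have hc: "h \<in> carrier G" by (rule sub_carrier[OF U h(1)])
      have "{u \<in> U. act u x = y} = (\<lambda>s. h \<otimes> s) ` S"
      proof
        show "(\<lambda>s. h \<otimes> s) ` S \<subseteq> {u \<in> U. act u x = y}"
          using h xX act_mult U by (auto simp: S_def subgroup.m_closed)
        show "{u \<in> U. act u x = y} \<subseteq> (\<lambda>s. h \<otimes> s) ` S"
        proof
          fix u assume u: "u \<in> {u \<in> U. act u x = y}"
          then have uU: "u \<in> U" "act u x = act h x" using h by auto
          have ih: "inv h \<in> U" by (rule subgroup.m_inv_closed[OF U h(1)])
          have "act (inv h \<otimes> u) x = x" using act_mult[OF ih uU(1) xX] uU(2) inv_act[OF h(1) xX] by simp
          then have "inv h \<otimes> u \<in> S" using ih uU U by (simp add: S_def subgroup.m_closed)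
          moreover have "h \<otimes> (inv h \<otimes> u) = u" using hc sub_carrier[OF U uU(1)] by simp
          ultimately show "u \<in> (\<lambda>s. h \<otimes> s) ` S" by force
        qed
      qed
      moreover have "inj_on (\<lambda>s. h \<otimes> s) S"
        using hc sub_carrier[OF S] by (auto intro!: inj_onI)
      ultimately show "card {u \<in> U. act u x = y} = card S" by (simp add: card_image)
    qed
    moreover obtain k where k: "card S = card N * k" using card_dvd[OF N(1) S NS] by blast
    ultimately have "r ^ m = card (orb x) * k" using cU card_pos[OF N(1)] by simp
    then have "card (orb x) dvd r ^ m" by simp
    then obtain i where i: "card (orb x) = r ^ i" using r divides_primepow_nat by blast
    have "i \<noteq> 0"
    proof
      assume "i = 0"
      then have "card (orb x) = 1" using i by simp
      then obtain y where "orb x = {y}" by (auto simp: card_1_singleton_iff)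
      then have "orb x = {x}" using self[OF xX] by simp
      then have "x \<in> F" using xX by (auto simp: F_def orb_def)
      then show False using x by simp
    qed
    then show ?thesis using i by simp
  qed
  have XF: "\<Union>(orb ` (X - F)) = X - F"
  proof
    show "X - F \<subseteq> \<Union>(orb ` (X - F))" using self by blast
    show "\<Union>(orb ` (X - F)) \<subseteq> X - F"
    proof
      fix y assume "y \<in> \<Union>(orb ` (X - F))"
      then obtain x where x: "x \<in> X - F" "y \<in> orb x" by blast
      have "y \<notin> F"
      proof
        assume "y \<in> F"
        then have "orb y = {y}" using subgroup.one_closed[OF U] by (auto simp: F_def orb_def)
        then have "x = y" using orb_eq[of x y] x self[of x] by auto
        then show False using x \<open>y \<in> F\<close> by simp
      qed
      then show "y \<in> X - F" using x orb_sub by blast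
    qed
  qed
  have "r dvd card (\<Union>(orb ` (X - F)))"
  proof (rule dvd_partition)
    show "finite (\<Union>(orb ` (X - F)))" unfolding XF using X by simp
    show "\<forall>c\<in>orb ` (X - F). r dvd card c" using orb_dvd by blast
    have "orb x \<inter> orb y = {}" if "x \<in> X" "y \<in> X" "orb x \<noteq> orb y" for x y
      using orb_eq that by blast
    then show "\<forall>c1\<in>orb ` (X - F). \<forall>c2\<in>orb ` (X - F). c1 \<noteq> c2 \<longrightarrow> c1 \<inter> c2 = {}"
      by auto
  qed
  then have "r dvd card X - card F" unfolding XF
    using X by (subst (asm) card_Diff_subset) (auto simp: F_def)
  moreover have "card F \<le> card X" using X by (simp add: F_def card_mono)
  ultimately have "[card F = card X] (mod r)" by (metis cong_altdef_nat cong_sym)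
  then show ?thesis by (simp add: F_def)
qed

text \<open>
  The group \<open>U\<close> acts on the right cosets of \<open>S\<close> in \<open>H\<close> by right multiplication, and \<open>S g\<close> is
  fixed exactly if \<open>g U g\<^sup>-\<^sup>1 \<subseteq> S\<close>.  This contains the conjugacy part of Sylow's theorem as well as
  the growth of normalizers in \<open>p\<close>-groups.
\<close>

lemma card_fixed_cosets_cong:
  assumes H: "subgroup H G" and U: "subgroup U G" "U \<subseteq> H" and S: "subgroup S G" "S \<subseteq> H"
    and N: "subgroup N G" "N \<subseteq> U" "N \<subseteq> S" "normalizes H N"
    and r: "prime r" and cU: "card U = r ^ m * card N" and cH: "card H = c * card S"
  shows "[card ((\<lambda>g. S #> g) ` {g \<in> H. \<forall>u\<in>U. conj_by g u \<in> S}) = c] (mod r)"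
proof -
  let ?X = "(\<lambda>g. S #> g) ` H"
  let ?act = "\<lambda>u C. C #> inv u"
  note Sc = subgroup.subset[OF S(1)]
  have Hc: "g \<in> carrier G" if "g \<in> H" for g using that H sub_carrier by blast
  have Uc: "g \<in> carrier G" if "g \<in> U" for g using that U sub_carrier by blast
  have fixed: "?act u (S #> g) = S #> g \<longleftrightarrow> conj_by g u \<in> S" if g: "g \<in> H" and u: "u \<in> U" for g u
  proof -
    have "?act u (S #> g) = S #> (g \<otimes> inv u)" using Hc[OF g] Uc[OF u] Sc by (simp add: coset_mult_assoc)
    also have "\<dots> = S #> g \<longleftrightarrow> g \<otimes> inv u \<in> S #> g"
      using Hc[OF g] Uc[OF u] S rcos_self[of "g \<otimes> inv u" S] repr_independence[of "g \<otimes> inv u" S g] by auto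
    also have "\<dots> \<longleftrightarrow> g \<otimes> inv u \<otimes> inv g \<in> S"
      using subgroup.rcos_module[OF S(1) is_group] Hc[OF g] Uc[OF u] by simp
    also have "\<dots> \<longleftrightarrow> inv (conj_by g u) \<in> S" using Hc[OF g] Uc[OF u] by (simp add: conj_by_def inv_mult_group m_assoc)
    also have "\<dots> \<longleftrightarrow> conj_by g u \<in> S"
      using Hc[OF g] Uc[OF u] subgroup.m_inv_closed[OF S(1)] by (metis conj_by_closed inv_inv)
    finally show ?thesis .
  qed
  have "[card {C \<in> ?X. \<forall>u\<in>U. ?act u C = C} = card ?X] (mod r)"
  proof (rule card_fixed_points_cong[OF U(1) N(1,2) r cU])
    show "finite ?X" using sub_finite[OF H] by simp
    show "?act u C \<in> ?X" if uC: "u \<in> U" "C \<in> ?X" for u C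
    proof -
      obtain g where g: "g \<in> H" "C = S #> g" using uC by blast
      have "?act u C = S #> (g \<otimes> inv u)" using g Hc Uc uC Sc by (simp add: coset_mult_assoc)
      moreover have "g \<otimes> inv u \<in> H" using g uC U H by (meson subgroup.m_closed subgroup.m_inv_closed subsetD)
      ultimately show ?thesis by blast
    qed
    show "?act \<one> C = C" if "C \<in> ?X" for C
      using that Sc Hc by (auto simp: r_coset_subset_G)
    show "?act (u \<otimes> v) C = ?act u (?act v C)" if uv: "u \<in> U" "v \<in> U" "C \<in> ?X" for u v C
    proof -
      have "C \<subseteq> carrier G" using uv Sc Hc r_coset_subset_G by blast
      then show ?thesis using uv Uc by (simp add: coset_mult_assoc inv_mult_group)
    qed
    show "?act u C = C" if uC: "u \<in> N" "C \<in> ?X" for u C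
    proof -
      obtain g where g: "g \<in> H" "C = S #> g" using uC by blast
      have "conj_by g u \<in> S" using N uC g normalizesD by blast
      moreover have "u \<in> U" using uC(1) N(2) by blast
      ultimately show ?thesis using fixed[OF g(1)] g(2) by simp
    qed
  qed
  moreover have "{C \<in> ?X. \<forall>u\<in>U. ?act u C = C} = (\<lambda>g. S #> g) ` {g \<in> H. \<forall>u\<in>U. conj_by g u \<in> S}"
    using fixed by auto
  moreover have "card ?X = c"
  proof -
    interpret H: group "G\<lparr>carrier := H\<rparr>" using H by (rule subgroup_imp_group)
    have "rcosets\<^bsub>G\<lparr>carrier := H\<rparr>\<^esub> S = ?X" by (auto simp: RCOSETS_def)
    then have "card ?X * card S = card H"
      using H.lagrange[OF subgroup_incl[OF S(1) H S(2)]] by (simp add: Coset.order_def)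
    then show ?thesis using cH card_pos[OF S(1)] by simp
  qed
  ultimately show ?thesis by simp
qed

lemma conjugate_into_sylow:
  assumes H: "subgroup H G" and U: "subgroup U G" "U \<subseteq> H" and S: "subgroup S G" "S \<subseteq> H"
    and r: "prime r" and cU: "card U = r ^ m" and cH: "card H = c * card S" and c: "\<not> r dvd c"
  shows "\<exists>g\<in>H. \<forall>u\<in>U. conj_by g u \<in> S"
proof -
  have N: "subgroup {\<one>} G" by (rule triv_subgroup)
  have "[card ((\<lambda>g. S #> g) ` {g \<in> H. \<forall>u\<in>U. conj_by g u \<in> S}) = c] (mod r)"
  proof (rule card_fixed_cosets_cong[OF H U S N _ _ _ r _ cH])
    show "{\<one>} \<subseteq> U" "{\<one>} \<subseteq> S" using U S subgroup.one_closed by auto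
    show "normalizes H {\<one>}" using H sub_carrier by (auto simp: normalizes_def)
    show "card U = r ^ m * card {\<one>}" using cU by simp
  qed
  then have "card ((\<lambda>g. S #> g) ` {g \<in> H. \<forall>u\<in>U. conj_by g u \<in> S}) \<noteq> 0"
    using c by (metis cong_dvd_iff dvd_0_right)
  then have "{g \<in> H. \<forall>u\<in>U. conj_by g u \<in> S} \<noteq> {}" by force
  then show ?thesis by blast
qed

text \<open>
  With \<open>U = S\<close>, the number of fixed cosets is divisible by the prime and \<open>S\<close> itself is one of them.
\<close>

lemma normalizer_grows:
  assumes H: "subgroup H G" and S: "subgroup S G" "S \<subseteq> H" "S \<noteq> H"
    and N: "subgroup N G" "N \<subseteq> S" "normalizes H N"
    and r: "prime r" and cH: "card H = r ^ m * card N"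
  shows "\<exists>g\<in>H - S. \<forall>u\<in>S. conj_by g u \<in> S"
proof -
  obtain c where c: "card H = c * card S" using card_dvd[OF S(1) H S(2)] by (metis dvd_div_mult_self)
  obtain k where k: "card S = k * card N" using card_dvd[OF N(1) S(1) N(2)] by (metis dvd_div_mult_self)
  have rm: "r ^ m = c * k" using c k cH card_pos[OF N(1)] by simp
  then have "k dvd r ^ m" "c dvd r ^ m" by auto
  then obtain i j where i: "k = r ^ i" "c = r ^ j" using r divides_primepow_nat by metis
  have "card S < card H" using S sub_finite[OF H] psubset_card_mono by blast
  then have "j \<noteq> 0" using c i by (cases "j = 0") auto
  then have rc: "r dvd c" using i by simp
  let ?F = "(\<lambda>g. S #> g) ` {g \<in> H. \<forall>u\<in>S. conj_by g u \<in> S}"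
  have "[card ?F = c] (mod r)"
    using card_fixed_cosets_cong[OF H S(1,2) S(1,2) N(1,2,2,3) r _ c, of i] k i by simp
  then have rF: "r dvd card ?F" using rc cong_dvd_iff by blast
  have one: "\<one> \<in> {g \<in> H. \<forall>u\<in>S. conj_by g u \<in> S}"
    using H S(1) sub_carrier by (auto simp: subgroup.one_closed)
  have SF: "S \<in> ?F"
    using one coset_mult_one[OF subgroup.subset[OF S(1)]] by (metis (no_types, lifting) image_eqI)
  have "\<not> ?F \<subseteq> {S}"
  proof
    assume "?F \<subseteq> {S}"
    then have "?F = {S}" using SF by blast
    then have "card ?F = 1" by simp
    then show False using rF r by (metis nat_dvd_1_iff_1 not_prime_1)
  qed
  then obtain g where g: "g \<in> H" "\<forall>u\<in>S. conj_by g u \<in> S" "S #> g \<noteq> S" by blast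
  have "g \<notin> S" using g(3) coset_join2[OF _ S(1)] sub_carrier[OF S(1)] by blast
  then show ?thesis using g by blast
qed

lemma normal_in_subgroup:
  assumes "subgroup H G" "subgroup M G" "M \<subseteq> H" "normalizes H M"
  shows "M \<lhd> G\<lparr>carrier := H\<rparr>"
proof -
  interpret H: group "G\<lparr>carrier := H\<rparr>" using assms(1) by (rule subgroup_imp_group)
  show ?thesis
    unfolding H.normal_inv_iff
  proof (intro conjI ballI)
    show "subgroup M (G\<lparr>carrier := H\<rparr>)" using subgroup_incl assms by blast
    fix x h assume a: "x \<in> carrier (G\<lparr>carrier := H\<rparr>)" "h \<in> M"
    then have "inv\<^bsub>G\<lparr>carrier := H\<rparr>\<^esub> x = inv x" using assms(1) by (simp add: m_inv_consistent)
    then show "x \<otimes>\<^bsub>G\<lparr>carrier := H\<rparr>\<^esub> h \<otimes>\<^bsub>G\<lparr>carrier := H\<rparr>\<^esub> inv\<^bsub>G\<lparr>carrier := H\<rparr>\<^esub> x \<in> M"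
      using a assms(4) by (simp add: normalizes_def conj_by_def)
  qed
qed

lemma card_factor_group:
  assumes "subgroup H G" "subgroup M G" "M \<subseteq> H"
  shows "Coset.order (G\<lparr>carrier := H\<rparr> Mod M) * card M = card H"
proof -
  interpret H: group "G\<lparr>carrier := H\<rparr>" using assms(1) by (rule subgroup_imp_group)
  show ?thesis
    using H.lagrange[OF subgroup_incl[OF assms(2,1,3)]] by (simp add: Coset.order_def FactGroup_def)
qed

text \<open>
  A maximal subgroup of the \<open>r\<close>-group \<open>H / N\<close> is normal because its normalizer is larger than itself,
  and has prime index because the quotient has a subgroup of order \<open>r\<close>.
\<close>

lemma normal_prime_index_over:
  assumes H: "subgroup H G" and K: "subgroup K G" "K \<subseteq> H" "K \<noteq> H"
    and N: "subgroup N G" "N \<subseteq> K" "normalizes H N"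
    and r: "prime r" and cH: "card H = r ^ m * card N"
  shows "\<exists>M. subgroup M G \<and> K \<subseteq> M \<and> M \<subseteq> H \<and> normalizes H M \<and> card H = r * card M"
proof -
  let ?P = "\<lambda>M. subgroup M G \<and> K \<subseteq> M \<and> M \<subseteq> H \<and> M \<noteq> H"
  have bd: "card M \<le> card H" if "?P M" for M using that sub_finite[OF H] card_mono by blast
  obtain M where M: "?P M" and max: "\<And>M'. ?P M' \<Longrightarrow> card M' \<le> card M"
  proof -
    have "\<exists>M. ?P M \<and> (\<forall>M'. ?P M' \<longrightarrow> card M' \<le> card M)"
    proof (rule ex_has_greatest_nat[where b = "Suc (card H)"])
      show "?P K" using K by blast
      show "\<forall>M. ?P M \<longrightarrow> card M < Suc (card H)" using bd le_imp_less_Suc by blast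
    qed
    then show ?thesis using that by blast
  qed
  have top: "L = H" if L: "subgroup L G" "M \<subseteq> L" "L \<subseteq> H" "L \<noteq> M" for L
  proof (rule ccontr)
    assume "L \<noteq> H"
    then have "card L \<le> card M" using max L M by blast
    then show False using L psubset_card_mono[OF sub_finite[OF L(1)], of M] by auto
  qed
  \<comment> \<open>The normalizer of \<open>M\<close> in \<open>H\<close>.\<close>
  define L where "L = {x \<in> H. \<forall>u\<in>M. conj_by x u \<in> M}"
  have Mc: "u \<in> carrier G" if "u \<in> M" for u using that M sub_carrier by blast
  have Hc: "u \<in> carrier G" if "u \<in> H" for u using that H sub_carrier by blast
  have L: "subgroup L G"
  proof (rule subgroupI)
    show "L \<subseteq> carrier G" using Hc by (auto simp: L_def)
    have "\<one> \<in> L" using subgroup.one_closed[OF H] Mc by (simp add: L_def)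
    then show "L \<noteq> {}" by blast
    show "inv a \<in> L" if a: "a \<in> L" for a
    proof -
      have "normalizes {a} M" using a by (simp add: L_def normalizes_def)
      then show ?thesis
        using a normalizes_inv[of a M] M Hc subgroup.m_inv_closed[OF H] by (auto simp: L_def)
    qed
    show "a \<otimes> b \<in> L" if "a \<in> L" "b \<in> L" for a b
      using that Mc Hc subgroup.m_closed[OF H] by (auto simp: L_def simp flip: conj_by_cj)
  qed
  have MsubL: "M \<subseteq> L"
    using M normalizes_self[of M] by (auto simp: L_def normalizes_def)
  obtain g where g: "g \<in> H - M" "\<forall>u\<in>M. conj_by g u \<in> M"
    using normalizer_grows[OF H _ _ _ N(1) _ N(3) r cH, of M] M N by blast
  then have "g \<in> L" by (simp add: L_def)
  then have "L = H" using top[OF L MsubL] g by (auto simp: L_def)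
  then have nM: "normalizes H M" by (auto simp: L_def normalizes_def)
  interpret n: normal M "G\<lparr>carrier := H\<rparr>" using normal_in_subgroup H M nM by blast
  have o: "Coset.order (G\<lparr>carrier := H\<rparr> Mod M) * card M = card H" using card_factor_group H M by blast
  obtain k where k: "card M = k * card N"
    using card_dvd[OF N(1), of M] M N by (metis dvd_div_mult_self order_trans)
  have "r ^ m = Coset.order (G\<lparr>carrier := H\<rparr> Mod M) * k" using o k cH card_pos[OF N(1)] by (simp add: mult.assoc[symmetric])
  then have "Coset.order (G\<lparr>carrier := H\<rparr> Mod M) dvd r ^ m" by simp
  then obtain j where j: "Coset.order (G\<lparr>carrier := H\<rparr> Mod M) = r ^ j" using r divides_primepow_nat by blast
  have "card M < card H" using M sub_finite[OF H] psubset_card_mono by blast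
  then have "j \<noteq> 0" using o j by (cases "j = 0") auto
  then have "r dvd Coset.order (G\<lparr>carrier := H\<rparr> Mod M)" using j by simp
  then obtain J where J: "subgroup J (G\<lparr>carrier := H\<rparr>)" "M \<subseteq> J" "card J = r * card M"
    using n.subgroup_over_of_prime_index[OF _ r] sub_finite[OF H] by auto
  have "subgroup J G" using incl_subgroup[OF H J(1)] .
  moreover have "J \<subseteq> H" using subgroup.subset[OF J(1)] by simp
  moreover have "J \<noteq> M"
  proof
    assume "J = M"
    then have "r = 1" using J(3) card_pos[of M] M by simp
    then show False using r by simp
  qed
  ultimately have "J = H" using top J(2) by blast
  then show ?thesis using M nM J(3) by blast
qed

lemma prime_index_normal:
  assumes H: "subgroup H G" and K: "subgroup K G" "K \<subseteq> H" "card H = r * card K"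
    and N: "subgroup N G" "N \<subseteq> K" "normalizes H N"
    and r: "prime r" and cH: "card H = r ^ m * card N"
  shows "normalizes H K"
proof -
  have "K \<noteq> H"
  proof
    assume "K = H"
    then have "r = 1" using K(3) card_pos[OF H] by simp
    then show False using r by simp
  qed
  then obtain M where M: "subgroup M G" "K \<subseteq> M" "normalizes H M" "card H = r * card M"
    using normal_prime_index_over[OF H K(1,2) _ N r cH] by blast
  have "card M = card K" using M K prime_gt_0_nat[OF r] by simp
  then have "K = M" using card_subset_eq[OF sub_finite[OF M(1)] M(2)] by simp
  then show ?thesis using M by simp
qed

section \<open>Characters with values modulo a prime\<close>

definition mod_character :: "nat \<Rightarrow> 'a set \<Rightarrow> ('a \<Rightarrow> int) \<Rightarrow> bool" where
  "mod_character t H f \<longleftrightarrow> (\<forall>g\<in>H. \<forall>h\<in>H. [f (g \<otimes> h) = f g + f h] (mod int t))"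

definition char_kernel :: "nat \<Rightarrow> 'a set \<Rightarrow> ('a \<Rightarrow> int) \<Rightarrow> 'a set" where
  "char_kernel t H f = {g \<in> H. int t dvd f g}"

lemma character_of_prime_index:
  assumes "subgroup H G" "subgroup M G" "M \<subseteq> H" "normalizes H M" "prime t" "card H = t * card M"
  shows "\<exists>f. mod_character t H f \<and> char_kernel t H f = M"
proof -
  interpret n: normal M "G\<lparr>carrier := H\<rparr>" using normal_in_subgroup assms by blast
  have o: "Coset.order (G\<lparr>carrier := H\<rparr> Mod M) = t"
    using card_factor_group[OF assms(1-3)] assms(6) card_pos[OF assms(2)] by simp
  obtain f :: "'a \<Rightarrow> int" where "\<forall>g\<in>H. \<forall>h\<in>H. [f (g \<otimes> h) = f g + f h] (mod int t)"
    "\<forall>g\<in>H. int t dvd f g \<longleftrightarrow> g \<in> M"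
    using n.prime_index_character[OF _ assms(5) o] sub_finite[OF assms(1)] by auto
  then show ?thesis using assms(3)
    by (intro exI[of _ f]) (auto simp: mod_character_def char_kernel_def)
qed

context
  fixes t H f
  assumes H: "subgroup H G" and f: "mod_character t H f"
begin

lemma mod_character_mult: "g \<in> H \<Longrightarrow> h \<in> H \<Longrightarrow> [f (g \<otimes> h) = f g + f h] (mod int t)"
  using f by (simp add: mod_character_def)

lemma mod_character_one: "int t dvd f \<one>"
  using mod_character_mult[of \<one> \<one>] subgroup.one_closed[OF H] by (simp add: cong_iff_dvd_diff)

lemma mod_character_inv: "g \<in> H \<Longrightarrow> [f (inv g) = - f g] (mod int t)"
proof -
  assume g: "g \<in> H"
  have "[f (g \<otimes> inv g) = f g + f (inv g)] (mod int t)"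
    using g H by (intro mod_character_mult) (auto intro: subgroup.m_inv_closed)
  moreover have "int t dvd f (g \<otimes> inv g)" using mod_character_one g H sub_carrier by simp
  ultimately have "int t dvd f g + f (inv g)" using cong_dvd_iff by blast
  then show ?thesis by (simp add: cong_iff_dvd_diff add.commute)
qed

lemma mod_character_pow: "g \<in> H \<Longrightarrow> [f (g [^] (n::nat)) = int n * f g] (mod int t)"
proof (induction n)
  case 0
  then show ?case using mod_character_one by (simp add: cong_iff_dvd_diff)
next
  case (Suc n)
  have "[f (g [^] n \<otimes> g) = f (g [^] n) + f g] (mod int t)"
    using Suc.prems pow_mem[OF H] by (intro mod_character_mult)
  also have "[f (g [^] n) + f g = int n * f g + f g] (mod int t)"
    using Suc by (intro cong_add) auto
  finally show ?case by (simp add: algebra_simps)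
qed

lemma mod_character_div_iff:
  assumes "g \<in> H" "h \<in> H"
  shows "int t dvd f (g \<otimes> inv h) \<longleftrightarrow> [f g = f h] (mod int t)"
proof -
  have "[f (g \<otimes> inv h) = f g + f (inv h)] (mod int t)"
    using assms H by (intro mod_character_mult) (auto intro: subgroup.m_inv_closed)
  also have "[f g + f (inv h) = f g - f h] (mod int t)"
    using cong_add[OF cong_refl mod_character_inv[OF assms(2)], of "f g"] by simp
  finally show ?thesis using cong_dvd_iff cong_iff_dvd_diff by blast
qed

lemma char_kernel_subgroup: "subgroup (char_kernel t H f) G"
proof (rule subgroupI)
  show "char_kernel t H f \<subseteq> carrier G" using H subgroup.subset by (auto simp: char_kernel_def)
  show "char_kernel t H f \<noteq> {}"
    using mod_character_one subgroup.one_closed[OF H] by (auto simp: char_kernel_def)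
  show "inv a \<in> char_kernel t H f" if "a \<in> char_kernel t H f" for a
    using that mod_character_inv[of a] H cong_dvd_iff[OF mod_character_inv[of a]]
    by (auto simp: char_kernel_def subgroup.m_inv_closed)
  show "a \<otimes> b \<in> char_kernel t H f" if "a \<in> char_kernel t H f" "b \<in> char_kernel t H f" for a b
    using that H cong_dvd_iff[OF mod_character_mult[of a b]]
    by (auto simp: char_kernel_def subgroup.m_closed)
qed

text \<open>
  There are no elements of order prime to \<open>t\<close> in \<open>\<int>/t\<close>.  Therefore characters modulo \<open>t\<close> vanish on
  every subgroup of order prime to \<open>t\<close>, in particular on the part of the tower below the step considered.
\<close>

lemma mod_character_coprime_order:
  assumes "g \<in> H" "g [^] n = \<one>" "coprime n t"
  shows "int t dvd f g"
proof -
  have "int t dvd int n * f g"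
    using mod_character_pow[OF assms(1), of n] mod_character_one cong_dvd_iff assms(2) by metis
  then show ?thesis using assms(3)
    by (metis coprime_commute coprime_dvd_mult_right_iff coprime_int_iff)
qed

lemma card_char_kernel:
  assumes t: "prime t" and nt: "\<exists>g\<in>H. \<not> int t dvd f g"
  shows "card H = t * card (char_kernel t H f)"
proof -
  obtain g0 where g0: "g0 \<in> H" "\<not> int t dvd f g0" using nt by blast
  have "coprime (f g0) (int t)" using g0(2) t by (simp add: coprime_commute prime_imp_coprime)
  then obtain u where u: "[f g0 * u = 1] (mod int t)" using cong_solve_coprime_int by blast
  have tp: "t > 0" using t prime_gt_0_nat by blast
  have surj: "\<exists>g\<in>H. f g mod int t = j" if j: "j \<in> {0..<int t}" for j
  proof -
    define n where "n = nat ((u * j) mod int t)"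
    have "int n = (u * j) mod int t" using tp by (simp add: n_def)
    then have n: "[int n = u * j] (mod int t)" by (simp add: cong_def)
    have "[f (g0 [^] n) = int n * f g0] (mod int t)" by (rule mod_character_pow[OF g0(1)])
    also have "[int n * f g0 = u * j * f g0] (mod int t)" using n by (rule cong_scalar_right)
    also have "u * j * f g0 = (f g0 * u) * j" by simp
    also have "[(f g0 * u) * j = 1 * j] (mod int t)" using u by (rule cong_scalar_right)
    finally have "[f (g0 [^] n) = j] (mod int t)" by simp
    then show ?thesis using j pow_mem[OF H g0(1)] by (auto simp: cong_def)
  qed
  let ?m = "\<lambda>g. f g mod int t"
  have im: "?m ` H = {0..<int t}" using surj tp by force
  have "card H = card (?m ` H) * card (char_kernel t H f)"
  proof (rule card_constant_fibres)
    show "finite H" using H by (rule sub_finite)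
    fix j assume "j \<in> ?m ` H"
    then obtain g where g: "g \<in> H" "?m g = j" by blast
    have gc: "g \<in> carrier G" using sub_carrier[OF H g(1)] .
    have "{x \<in> H. ?m x = j} = (\<lambda>k. k \<otimes> g) ` char_kernel t H f"
    proof
      show "(\<lambda>k. k \<otimes> g) ` char_kernel t H f \<subseteq> {x \<in> H. ?m x = j}"
      proof clarsimp
        fix k assume k: "k \<in> char_kernel t H f"
        then have kH: "k \<in> H" "[f k = 0] (mod int t)" by (auto simp: char_kernel_def cong_0_iff)
        have "[f (k \<otimes> g) = 0 + f g] (mod int t)"
          using mod_character_mult[OF kH(1) g(1)] cong_add[OF kH(2) cong_refl] cong_trans by blast
        then show "k \<otimes> g \<in> H \<and> ?m (k \<otimes> g) = j"
          using kH g H by (simp add: cong_def subgroup.m_closed)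
      qed
      show "{x \<in> H. ?m x = j} \<subseteq> (\<lambda>k. k \<otimes> g) ` char_kernel t H f"
      proof
        fix x assume x: "x \<in> {x \<in> H. ?m x = j}"
        then have "int t dvd f (x \<otimes> inv g)"
          using mod_character_div_iff[of x g] g by (simp add: cong_def)
        then have "x \<otimes> inv g \<in> char_kernel t H f"
          using x g H by (simp add: char_kernel_def subgroup.m_closed subgroup.m_inv_closed)
        moreover have "x \<otimes> inv g \<otimes> g = x" using x gc sub_carrier[OF H] by (simp add: m_assoc)
        ultimately show "x \<in> (\<lambda>k. k \<otimes> g) ` char_kernel t H f" by force
      qed
    qed
    moreover have "inj_on (\<lambda>k. k \<otimes> g) (char_kernel t H f)"
      using gc sub_carrier[OF char_kernel_subgroup] by (auto intro!: inj_onI)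
    ultimately show "card {x \<in> H. ?m x = j} = card (char_kernel t H f)" by (simp add: card_image)
  qed
  then show ?thesis by (simp add: im)
qed

text \<open>
  An automorphism of \<open>H / ker f\<close>, a group of order \<open>1\<close> or \<open>t\<close>, is multiplication by a scalar.  The proof
  compares \<open>g\<close> with the power of a fixed element that has the same value under \<open>f\<close>.
\<close>

lemma eigen_of_normalizes_kernel:
  assumes t: "prime t" and x: "x \<in> carrier G" "normalizes {x} H" "normalizes {x} (char_kernel t H f)"
  shows "\<exists>k. \<forall>g\<in>H. [f (conj_by x g) = k * f g] (mod int t)"
proof (cases "\<exists>g\<in>H. \<not> int t dvd f g")
  case False
  then have "\<forall>g\<in>H. [f (conj_by x g) = 1 * f g] (mod int t)"
    using normalizesD[OF x(2)] by (simp add: cong_iff_dvd_diff)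
  then show ?thesis by blast
next
  case True
  then obtain g0 where g0: "g0 \<in> H" "\<not> int t dvd f g0" by blast
  have "coprime (f g0) (int t)" using g0(2) t by (simp add: coprime_commute prime_imp_coprime)
  then obtain u where u: "[f g0 * u = 1] (mod int t)" using cong_solve_coprime_int by blast
  have tp: "t > 0" using t prime_gt_0_nat by blast
  have cH: "conj_by x g \<in> H" if "g \<in> H" for g using normalizesD[OF x(2)] that by blast
  have "[f (conj_by x g) = (u * f (conj_by x g0)) * f g] (mod int t)" if g: "g \<in> H" for g
  proof -
    define n where "n = nat ((u * f g) mod int t)"
    have "int n = (u * f g) mod int t" using tp by (simp add: n_def)
    then have n: "[int n = u * f g] (mod int t)" by (simp add: cong_def)
    have gn: "g0 [^] n \<in> H" using pow_mem[OF H g0(1)] .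
    have "[f (g0 [^] n) = int n * f g0] (mod int t)" by (rule mod_character_pow[OF g0(1)])
    also have "[int n * f g0 = u * f g * f g0] (mod int t)" using n by (rule cong_scalar_right)
    also have "u * f g * f g0 = (f g0 * u) * f g" by simp
    also have "[(f g0 * u) * f g = 1 * f g] (mod int t)" using u by (rule cong_scalar_right)
    finally have "[f g = f (g0 [^] n)] (mod int t)" by (simp add: cong_sym)
    then have "g \<otimes> inv (g0 [^] n) \<in> char_kernel t H f"
      using mod_character_div_iff[OF g gn] g gn H
      by (simp add: char_kernel_def subgroup.m_closed subgroup.m_inv_closed)
    then have "conj_by x (g \<otimes> inv (g0 [^] n)) \<in> char_kernel t H f" using normalizesD[OF x(3)] by blast
    moreover have "conj_by x (g \<otimes> inv (g0 [^] n)) = conj_by x g \<otimes> inv (conj_by x (g0 [^] n))"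
      using x g gn sub_carrier[OF H] by (simp add: conj_by_mult conj_by_inv)
    ultimately have "int t dvd f (conj_by x g \<otimes> inv (conj_by x (g0 [^] n)))" by (simp add: char_kernel_def)
    then have "[f (conj_by x g) = f (conj_by x (g0 [^] n))] (mod int t)"
      using mod_character_div_iff cH g gn by blast
    also have "conj_by x (g0 [^] n) = conj_by x g0 [^] n"
    proof (induction n)
      case 0 then show ?case using x by simp
    next
      case (Suc n)
      then show ?case using x sub_carrier[OF H g0(1)] by (simp add: conj_by_mult)
    qed
    also have "[f (conj_by x g0 [^] n) = int n * f (conj_by x g0)] (mod int t)"
      by (rule mod_character_pow[OF cH[OF g0(1)]])
    also have "[int n * f (conj_by x g0) = u * f g * f (conj_by x g0)] (mod int t)"
      using n by (rule cong_scalar_right)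
    finally show ?thesis by (simp add: mult_ac)
  qed
  then show ?thesis by blast
qed

text \<open>
  The eigenvalue is invertible modulo \<open>t\<close> unless \<open>f\<close> vanishes, so Fermat's little theorem applies.
\<close>

lemma eigen_pow:
  assumes t: "prime t" and x: "x \<in> carrier G" "normalizes {x} H"
    and k: "\<And>g. g \<in> H \<Longrightarrow> [f (conj_by x g) = k * f g] (mod int t)" and g: "g \<in> H"
  shows "[f (conj_by (x [^] (t - 1)) g) = f g] (mod int t)"
proof -
  have iter: "(conj_by x ^^ n) g \<in> H \<and> [f ((conj_by x ^^ n) g) = k ^ n * f g] (mod int t)" for n
  proof (induction n)
    case (Suc n)
    have "[f (conj_by x ((conj_by x ^^ n) g)) = k * f ((conj_by x ^^ n) g)] (mod int t)" using k Suc by blast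
    also have "[k * f ((conj_by x ^^ n) g) = k * (k ^ n * f g)] (mod int t)"
      using Suc by (intro cong_scalar_left) blast
    finally show ?case using Suc normalizesD[OF x(2)] by (simp add: mult_ac)
  qed (use g in simp)
  have e: "conj_by (x [^] (t - 1)) g = (conj_by x ^^ (t - 1)) g" using x g sub_carrier[OF H] by (simp add: conj_by_pow)
  show ?thesis
  proof (cases "int t dvd k")
    case True
    have "int t dvd f h" if h: "h \<in> H" for h
    proof -
      have "conj_by (inv x) h \<in> H" using normalizes_inv[OF x(1) H x(2) h] .
      then have "[f h = k * f (conj_by (inv x) h)] (mod int t)"
        using k[of "conj_by (inv x) h"] x h sub_carrier[OF H] by simp
      then show ?thesis using True cong_dvd_iff by fastforce
    qed
    then show ?thesis using iter g e by (simp add: cong_iff_dvd_diff)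
  next
    case False
    have "[f (conj_by (x [^] (t - 1)) g) = k ^ (t - 1) * f g] (mod int t)" using iter e by simp
    also have "[k ^ (t - 1) * f g = 1 * f g] (mod int t)"
      using fermat_int[OF t False] by (rule cong_scalar_right)
    finally show ?thesis by simp
  qed
qed

end

text \<open>
  This is \<open>x y x\<^sup>-\<^sup>1 y\<^sup>-\<^sup>1\<close>.  That \<open>commutator z g\<close> lies in \<open>N\<close> says that \<open>z\<close> fixes the coset of \<open>g\<close> modulo
  \<open>N\<close>, and \<open>commutator (commutator x y) g \<in> N\<close> for all \<open>g\<close> that \<open>x\<close> and \<open>y\<close> commute in their action modulo
  \<open>N\<close>.
\<close>

abbreviation commutator :: "'a \<Rightarrow> 'a \<Rightarrow> 'a" where
  "commutator x y \<equiv> conj_by x y \<otimes> inv y"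

lemma conj_by_commutator:
  "x \<in> carrier G \<Longrightarrow> y \<in> carrier G \<Longrightarrow> g \<in> carrier G \<Longrightarrow>
    conj_by (commutator x y) (conj_by y (conj_by x g)) = conj_by x (conj_by y g)"
  by (simp add: conj_by_cj) (simp add: conj_by_def m_assoc)

lemma commuting_values:
  assumes H: "subgroup H G" and x: "x \<in> carrier G" "normalizes {x} H"
    and y: "y \<in> carrier G" "normalizes {y} H"
    and c: "\<And>g. g \<in> H \<Longrightarrow> [f (conj_by x (conj_by y g)) = f (conj_by y (conj_by x g))] (mod int t)" and g: "g \<in> H"
  shows "[f (conj_by (commutator x y) g) = f g] (mod int t)"
proof -
  define h where "h = conj_by (inv x) (conj_by (inv y) g)"
  have h: "h \<in> H" unfolding h_def
    using normalizes_inv[OF x(1) H x(2)] normalizes_inv[OF y(1) H y(2)] g by blast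
  have g': "g = conj_by y (conj_by x h)" using x y g sub_carrier[OF H] by (simp add: h_def)
  show ?thesis unfolding g'
    using conj_by_commutator[OF x(1) y(1), of h] c[OF h] sub_carrier[OF H h] by simp
qed

lemma values_commute:
  assumes H: "subgroup H G" and f: "mod_character t H f"
    and N: "\<And>n. n \<in> H \<Longrightarrow> n \<in> N \<Longrightarrow> int t dvd f n"
    and x: "x \<in> carrier G" "normalizes {x} H" and y: "y \<in> carrier G" "normalizes {y} H"
    and c: "\<And>g. g \<in> H \<Longrightarrow> commutator (commutator x y) g \<in> N" and g: "g \<in> H"
  shows "[f (conj_by x (conj_by y g)) = f (conj_by y (conj_by x g))] (mod int t)"
proof -
  let ?h = "conj_by y (conj_by x g)"
  have h: "?h \<in> H" "conj_by x (conj_by y g) \<in> H" using x y g by (auto simp: normalizes_def)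
  have e: "conj_by (commutator x y) ?h = conj_by x (conj_by y g)"
    using conj_by_commutator x y g sub_carrier[OF H] by blast
  have "conj_by x (conj_by y g) \<otimes> inv ?h \<in> N" using c[OF h(1)] unfolding e .
  moreover have "conj_by x (conj_by y g) \<otimes> inv ?h \<in> H" using h H by (simp add: subgroup.m_closed subgroup.m_inv_closed)
  ultimately show ?thesis using N mod_character_div_iff[OF H f h(2,1)] by blast
qed

text \<open>
  A linear operator for which every vector is an eigenvector is a scalar.  The usual argument with
  \<open>f\<^sub>0 + f\<close> is used for characters that do not vanish on the kernel of \<open>f\<^sub>0\<close>; the others are determined by
  \<open>f\<^sub>0\<close>.
\<close>

lemma uniform_eigenvalue:
  assumes H: "subgroup H G" and t: "prime t" and x: "normalizes {x} H"
    and ev: "\<And>f. mod_character t H f \<Longrightarrow> \<exists>k. \<forall>g\<in>H. [f (conj_by x g) = k * f g] (mod int t)"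
  shows "\<exists>k. \<forall>f. mod_character t H f \<longrightarrow> (\<forall>g\<in>H. [f (conj_by x g) = k * f g] (mod int t))"
proof (cases "\<exists>f. mod_character t H f \<and> (\<exists>g\<in>H. \<not> int t dvd f g)")
  case False
  then have "[f (conj_by x g) = 1 * f g] (mod int t)" if "mod_character t H f" "g \<in> H" for f g
    using that normalizesD[OF x] by (simp add: cong_iff_dvd_diff)
  then show ?thesis by blast
next
  case True
  then obtain f0 g0 where f0: "mod_character t H f0" and g0: "g0 \<in> H" "\<not> int t dvd f0 g0" by blast
  obtain k0 where k0: "\<And>g. g \<in> H \<Longrightarrow> [f0 (conj_by x g) = k0 * f0 g] (mod int t)" using ev[OF f0] by blast
  have xH: "conj_by x g \<in> H" if "g \<in> H" for g using normalizesD[OF x] that by blast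
  have cancel: "[a = b] (mod int t)" if "[a * c = b * c] (mod int t)" "\<not> int t dvd c" for a b c
    using that t by (metis cong_mult_rcancel coprime_commute prime_imp_coprime prime_nat_int_transfer)
  have "[f (conj_by x g) = k0 * f g] (mod int t)" if f: "mod_character t H f" and g: "g \<in> H" for f g
  proof (cases "\<exists>h\<in>H. int t dvd f0 h \<and> \<not> int t dvd f h")
    case True
    then obtain h where h: "h \<in> H" "int t dvd f0 h" "\<not> int t dvd f h" by blast
    obtain k where k: "\<And>g. g \<in> H \<Longrightarrow> [f (conj_by x g) = k * f g] (mod int t)" using ev[OF f] by blast
    \<comment> \<open>At \<open>h\<close> only \<open>f\<close> contributes to the character \<open>f0 + f\<close>, which identifies its eigenvalue \<open>l\<close> with \<open>k\<close>;
      at \<open>g0\<close> it is then identified with \<open>k0\<close>.\<close>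
    let ?s = "\<lambda>g. f0 g + f g"
    have "mod_character t H ?s"
      unfolding mod_character_def
    proof (intro ballI)
      fix a b assume ab: "a \<in> H" "b \<in> H"
      have "[?s (a \<otimes> b) = (f0 a + f0 b) + (f a + f b)] (mod int t)"
        using mod_character_mult[OF H f0 ab] mod_character_mult[OF H f ab] by (rule cong_add)
      then show "[?s (a \<otimes> b) = ?s a + ?s b] (mod int t)" by (simp add: add_ac)
    qed
    then obtain l where l: "\<And>g. g \<in> H \<Longrightarrow> [?s (conj_by x g) = l * ?s g] (mod int t)" using ev by blast
    have sum: "[k0 * f0 g + k * f g = l * f0 g + l * f g] (mod int t)" if "g \<in> H" for g
    proof -
      have "[k0 * f0 g + k * f g = ?s (conj_by x g)] (mod int t)"
        using k0[OF that] k[OF that] by (intro cong_add) (auto simp: cong_sym)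
      then show ?thesis using l[OF that] cong_trans by (simp add: distrib_left) blast
    qed
    have "[k * f h = l * f h] (mod int t)"
    proof -
      have "int t dvd (k0 * f0 h + k * f h) - (l * f0 h + l * f h)"
        using sum[OF h(1)] by (simp add: cong_iff_dvd_diff)
      moreover have "(k0 * f0 h + k * f h) - (l * f0 h + l * f h) = (k0 - l) * f0 h + (k * f h - l * f h)"
        by (simp add: algebra_simps)
      moreover have "int t dvd (k0 - l) * f0 h" using h by simp
      ultimately show ?thesis by (metis cong_iff_dvd_diff dvd_add_right_iff)
    qed
    then have kl: "[k = l] (mod int t)" using cancel h by blast
    have "[k0 * f0 g0 = l * f0 g0] (mod int t)"
    proof -
      have "[k0 * f0 g0 + k * f g0 = l * f0 g0 + k * f g0] (mod int t)"
        using sum[OF g0(1)] cong_add[OF cong_refl cong_scalar_right[OF cong_sym[OF kl]]] cong_trans by blast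
      then show ?thesis by (simp add: cong_add_rcancel)
    qed
    then have "[k0 = l] (mod int t)" using cancel g0 by blast
    then have "[k = k0] (mod int t)" using kl cong_sym cong_trans by blast
    then show ?thesis using k[OF g] cong_scalar_right cong_trans by blast
  next
    case False
    define n where "n = nat (k0 mod int t)"
    have "int n = k0 mod int t" using t prime_gt_0_nat by (simp add: n_def)
    then have n: "[int n = k0] (mod int t)" by (simp add: cong_def)
    have gn: "g [^] n \<in> H" using pow_mem[OF H g] .
    have pw: "[F (g [^] n) = k0 * F g] (mod int t)" if "mod_character t H F" for F
      using mod_character_pow[OF H that g, of n] cong_scalar_right[OF n] cong_trans by blast
    have "[f0 (conj_by x g) = f0 (g [^] n)] (mod int t)" using k0[OF g] pw[OF f0] cong_sym cong_trans by blast
    then have "int t dvd f0 (conj_by x g \<otimes> inv (g [^] n))"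
      using mod_character_div_iff[OF H f0 xH[OF g] gn] by blast
    moreover have "conj_by x g \<otimes> inv (g [^] n) \<in> H"
      using xH[OF g] gn H by (simp add: subgroup.m_closed subgroup.m_inv_closed)
    ultimately have "int t dvd f (conj_by x g \<otimes> inv (g [^] n))" using False by blast
    then have "[f (conj_by x g) = f (g [^] n)] (mod int t)"
      using mod_character_div_iff[OF H f xH[OF g] gn] by blast
    then show ?thesis using pw[OF f] cong_trans by blast
  qed
  then show ?thesis by blast
qed

section \<open>Coprime action on sections\<close>

lemma commutator_mult:
  assumes "z \<in> carrier G" "g \<in> carrier G" "h \<in> carrier G"
  shows "commutator z (g \<otimes> h) = commutator z g \<otimes> conj_by g (commutator z h)"
  using assms by (simp add: conj_by_mult inv_mult_group) (simp add: conj_by_def m_assoc)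

lemma commutator_inv:
  assumes "z \<in> carrier G" "g \<in> carrier G"
  shows "commutator z (inv g) = conj_by (inv g) (inv (commutator z g))"
  using assms by (simp add: conj_by_inv inv_mult_group) (simp add: conj_by_def m_assoc inv_mult_group)

lemma relative_centralizer_subgroup:
  assumes L: "subgroup L G" and N: "subgroup N G" "normalizes L N" and z: "z \<in> carrier G"
  shows "subgroup {g \<in> L. commutator z g \<in> N} G"
proof (rule subgroupI)
  have Lc: "g \<in> carrier G" if "g \<in> L" for g using that L sub_carrier by blast
  show "{g \<in> L. commutator z g \<in> N} \<subseteq> carrier G" using Lc by blast
  have "\<one> \<in> {g \<in> L. commutator z g \<in> N}"
    using z subgroup.one_closed[OF L] subgroup.one_closed[OF N(1)] by simp
  then show "{g \<in> L. commutator z g \<in> N} \<noteq> {}" by blast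
  show "inv a \<in> {g \<in> L. commutator z g \<in> N}" if a: "a \<in> {g \<in> L. commutator z g \<in> N}" for a
  proof -
    have aL: "a \<in> L" "commutator z a \<in> N" using a by simp_all
    have "conj_by (inv a) (inv (commutator z a)) \<in> N"
      by (rule normalizesD[OF N(2) subgroup.m_inv_closed[OF L aL(1)] subgroup.m_inv_closed[OF N(1) aL(2)]])
    then have "commutator z (inv a) \<in> N" using commutator_inv[OF z Lc[OF aL(1)]] by simp
    then show ?thesis using subgroup.m_inv_closed[OF L aL(1)] by simp
  qed
  show "a \<otimes> b \<in> {g \<in> L. commutator z g \<in> N}"
    if ab: "a \<in> {g \<in> L. commutator z g \<in> N}" "b \<in> {g \<in> L. commutator z g \<in> N}" for a b
  proof -
    have c: "a \<in> L" "commutator z a \<in> N" "b \<in> L" "commutator z b \<in> N" using ab by simp_all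
    have "commutator z a \<otimes> conj_by a (commutator z b) \<in> N"
      by (rule subgroup.m_closed[OF N(1) c(2) normalizesD[OF N(2) c(1) c(4)]])
    then have "commutator z (a \<otimes> b) \<in> N"
      using commutator_mult[OF z Lc[OF c(1)] Lc[OF c(3)]] by simp
    then show ?thesis using subgroup.m_closed[OF L c(1,3)] by simp
  qed
qed

text \<open>
  The heart of coprime action.  If \<open>z\<close> acts trivially on \<open>L / K\<close>, then the \<open>q\<close>-group of all elements of \<open>Q\<close> with
  this property permutes the \<open>N\<close>-cosets that make up one \<open>K\<close>-coset.  Their number is a power of \<open>t \<noteq> q\<close>,
  hence one of them is fixed.
\<close>

lemma fixed_coset_lift:
  assumes L: "subgroup L G" and K: "subgroup K G" "K \<subseteq> L"
    and N: "subgroup N G" "N \<subseteq> K" "normalizes L N"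
    and Q: "subgroup Q G" "normalizes Q L" "normalizes Q N" "card Q = q ^ n"
    and q: "prime q" and t: "prime t" "t \<noteq> q" and cK: "card K = t ^ j * card N"
    and z: "z \<in> Q" "\<And>h. h \<in> L \<Longrightarrow> commutator z h \<in> K" and g: "g \<in> L"
  shows "\<exists>h\<in>K #> g. commutator z h \<in> N"
proof -
  define Z where "Z = {y \<in> Q. \<forall>h\<in>L. commutator y h \<in> K}"
  have Qc: "y \<in> carrier G" if "y \<in> Q" for y using that Q sub_carrier by blast
  have Lc: "y \<in> carrier G" if "y \<in> L" for y using that L sub_carrier by blast
  have KL: "y \<in> L" if "y \<in> K" for y using that K by blast
  have Kc: "y \<in> carrier G" if "y \<in> K" for y using that KL Lc by blast
  have gc: "g \<in> carrier G" using Lc g .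
  have QL: "conj_by y h \<in> L" if "y \<in> Q" "h \<in> L" for y h using normalizesD[OF Q(2)] that by blast
  have Z: "subgroup Z G"
  proof (rule subgroupI)
    show "Z \<subseteq> carrier G" using Qc by (auto simp: Z_def)
    have "\<one> \<in> Z"
      using subgroup.one_closed[OF Q(1)] subgroup.one_closed[OF K(1)] Lc by (simp add: Z_def)
    then show "Z \<noteq> {}" by blast
    show "inv a \<in> Z" if a: "a \<in> Z" for a
    proof -
      have aQ: "a \<in> Q" using a by (simp add: Z_def)
      have nL: "normalizes {a} L" using QL aQ by (simp add: normalizes_def)
      have "commutator (inv a) h \<in> K" if h: "h \<in> L" for h
      proof -
        define h' where "h' = conj_by (inv a) h"
        have h': "h' \<in> L" unfolding h'_def using normalizes_inv[OF Qc[OF aQ] L nL h] .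
        have e: "h = conj_by a h'" using Qc aQ h Lc by (simp add: h'_def)
        have "commutator (inv a) h = inv (commutator a h')"
          unfolding e using Qc aQ h' Lc by (simp add: inv_mult_group)
        then show ?thesis using a h' subgroup.m_inv_closed[OF K(1)] by (auto simp: Z_def)
      qed
      then show ?thesis using aQ subgroup.m_inv_closed[OF Q(1)] by (simp add: Z_def)
    qed
    show "a \<otimes> b \<in> Z" if ab: "a \<in> Z" "b \<in> Z" for a b
    proof -
      have abQ: "a \<in> Q" "b \<in> Q" using ab by (auto simp: Z_def)
      have "commutator (a \<otimes> b) h \<in> K" if h: "h \<in> L" for h
      proof -
        have "commutator (a \<otimes> b) h = commutator a (conj_by b h) \<otimes> commutator b h"
          using Qc abQ h Lc by (simp add: conj_by_cj m_assoc)
        moreover have "commutator a (conj_by b h) \<in> K" "commutator b h \<in> K"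
          using ab h QL abQ by (auto simp: Z_def)
        ultimately show ?thesis using subgroup.m_closed[OF K(1)] by simp
      qed
      then show ?thesis using abQ subgroup.m_closed[OF Q(1)] by (simp add: Z_def)
    qed
  qed
  have ZQ: "Z \<subseteq> Q" by (auto simp: Z_def)
  have zZ: "z \<in> Z" using z by (simp add: Z_def)
  have "card Z dvd q ^ n" using card_dvd[OF Z Q(1) ZQ] Q(4) by simp
  then obtain m where m: "card Z = q ^ m" using q divides_primepow_nat by blast
  let ?X = "(\<lambda>h. N #> h) ` (K #> g)"
  let ?act = "\<lambda>y C. conj_by y ` C"
  note Nc = subgroup.subset[OF N(1)]
  have Kg: "h \<in> L" if "h \<in> K #> g" for h
    using that KL g subgroup.m_closed[OF L] by (auto simp: r_coset_def)
  have act: "?act y (N #> h) = N #> conj_by y h" if y: "y \<in> Z" and h: "h \<in> L" for y h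
  proof -
    have yQ: "y \<in> Q" using y ZQ by blast
    have im: "conj_by y ` N = N" using conj_by_image_eq[OF Qc[OF yQ] N(1)] normalizesD[OF Q(3) yQ] by blast
    have "?act y (N #> h) = (\<lambda>n. conj_by y n \<otimes> conj_by y h) ` N"
      using Qc[OF yQ] Lc[OF h] sub_carrier[OF N(1)] by (auto simp: r_coset_def conj_by_mult image_iff)
    also have "\<dots> = (\<lambda>n. n \<otimes> conj_by y h) ` (conj_by y ` N)" by (simp add: image_image)
    also have "\<dots> = N #> conj_by y h" unfolding im by (auto simp: r_coset_def)
    finally show ?thesis .
  qed
  have stay: "conj_by y h \<in> K #> g" if y: "y \<in> Z" and h: "h \<in> K #> g" for y h
  proof -
    obtain k where k: "k \<in> K" "h = k \<otimes> g" using h by (auto simp: r_coset_def)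
    have "commutator y h \<in> K" using y Kg[OF h] by (simp add: Z_def)
    then have "commutator y h \<otimes> k \<in> K" by (rule subgroup.m_closed[OF K(1) _ k(1)])
    moreover have "conj_by y h = (commutator y h \<otimes> k) \<otimes> g"
      using k Kc gc Qc y ZQ subsetD[OF ZQ y] by (simp add: m_assoc inv_mult_group)
    ultimately show ?thesis unfolding r_coset_def by blast
  qed
  have "[card {C \<in> ?X. \<forall>y\<in>Z. ?act y C = C} = card ?X] (mod q)"
  proof (rule card_fixed_points_cong[OF Z triv_subgroup _ q])
    show "{\<one>} \<subseteq> Z" using subgroup.one_closed[OF Z] by blast
    show "card Z = q ^ m * card {\<one>}" using m by simp
    have "finite (K #> g)" using sub_finite[OF L] Kg finite_subset[of "K #> g" L] by blast
    then show "finite ?X" by blast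
    show "?act y C \<in> ?X" if "y \<in> Z" "C \<in> ?X" for y C
      using that act stay Kg by auto
    show one: "?act \<one> C = C" if "C \<in> ?X" for C
      using that act[OF subgroup.one_closed[OF Z]] Kg Lc by auto
    show "?act (y \<otimes> y') C = ?act y (?act y' C)" if yC: "y \<in> Z" "y' \<in> Z" "C \<in> ?X" for y y' C
    proof -
      obtain h where h: "h \<in> K #> g" "C = N #> h" using yC by blast
      have c: "y \<in> carrier G" "y' \<in> carrier G" "h \<in> carrier G" "y' \<in> Q"
        using yC(1,2) ZQ Qc Lc Kg[OF h(1)] by blast+
      have "?act (y \<otimes> y') C = N #> conj_by (y \<otimes> y') h"
        unfolding h(2) using subgroup.m_closed[OF Z yC(1,2)] Kg[OF h(1)] by (rule act)
      also have "\<dots> = N #> conj_by y (conj_by y' h)" using c by (simp add: conj_by_cj)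
      also have "\<dots> = ?act y (?act y' C)"
        unfolding h(2) act[OF yC(2) Kg[OF h(1)]] using act[OF yC(1) QL[OF c(4) Kg[OF h(1)]]] by simp
      finally show ?thesis .
    qed
    show "?act y C = C" if "y \<in> {\<one>}" "C \<in> ?X" for y C using that one by simp
  qed
  moreover have "card ?X = t ^ j"
  proof -
    let ?Y = "(\<lambda>k. N #> k) ` K"
    interpret K: group "G\<lparr>carrier := K\<rparr>" using K(1) by (rule subgroup_imp_group)
    have "rcosets\<^bsub>G\<lparr>carrier := K\<rparr>\<^esub> N = ?Y" by (auto simp: RCOSETS_def)
    then have "card ?Y * card N = card K"
      using K.lagrange[OF subgroup_incl[OF N(1) K(1) N(2)]] by (simp add: Coset.order_def)
    then have Y: "card ?Y = t ^ j" using cK card_pos[OF N(1)] by simp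
    have kg: "(N #> k) #> g = N #> (k \<otimes> g)" if "k \<in> K" for k
      using that Kc gc Nc by (simp add: coset_mult_assoc)
    have "(\<lambda>C. C #> g) ` ?Y = ?X"
      unfolding image_image r_coset_def[of G K g] using kg by (auto simp: image_iff)
    moreover have "inj_on (\<lambda>C. C #> g) ?Y"
    proof (rule inj_onI)
      fix C D assume CD: "C \<in> ?Y" "D \<in> ?Y" "C #> g = D #> g"
      have "C \<subseteq> carrier G" "D \<subseteq> carrier G" using CD(1,2) Nc Kc r_coset_subset_G by blast+
      then have "C = (C #> g) #> inv g" "D = (D #> g) #> inv g" using gc by (simp_all add: coset_mult_assoc)
      then show "C = D" using CD(3) by simp
    qed
    ultimately show ?thesis using Y card_image by metis
  qed
  ultimately have cong: "[card {C \<in> ?X. \<forall>y\<in>Z. ?act y C = C} = t ^ j] (mod q)" by simp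
  have "\<not> q dvd t ^ j" using q t prime_dvd_power primes_dvd_imp_eq by blast
  then have "card {C \<in> ?X. \<forall>y\<in>Z. ?act y C = C} \<noteq> 0" using cong_dvd_iff[OF cong] by (metis dvd_0_right)
  then have "{C \<in> ?X. \<forall>y\<in>Z. ?act y C = C} \<noteq> {}" by force
  then obtain h where h: "h \<in> K #> g" "?act z (N #> h) = N #> h" using zZ by blast
  have hc: "h \<in> carrier G" "z \<in> carrier G" using Lc Kg[OF h(1)] Qc z by blast+
  have "N #> conj_by z h = N #> h" using act[OF zZ Kg[OF h(1)]] h(2) by simp
  then have "conj_by z h \<in> N #> h" using rcos_self[OF _ N(1), of "conj_by z h"] hc by simp
  then have "commutator z h \<in> N" using subgroup.rcos_module[OF N(1) is_group] hc by simp
  then show ?thesis using h(1) by blast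
qed

lemma trivial_action_lift:
  assumes L: "subgroup L G" and K: "subgroup K G" "K \<subseteq> L"
    and N: "subgroup N G" "N \<subseteq> K" "normalizes L N"
    and Q: "subgroup Q G" "normalizes Q L" "normalizes Q N" "card Q = q ^ n"
    and q: "prime q" and t: "prime t" "t \<noteq> q" and cK: "card K = t ^ j * card N"
    and z: "z \<in> Q" "\<And>h. h \<in> L \<Longrightarrow> commutator z h \<in> K" "\<And>h. h \<in> K \<Longrightarrow> commutator z h \<in> N"
    and g: "g \<in> L"
  shows "commutator z g \<in> N"
proof -
  obtain h where h: "h \<in> K #> g" "commutator z h \<in> N"
    using fixed_coset_lift[OF L K N Q q t cK z(1,2) g] by blast
  obtain k where k: "k \<in> K" "h = k \<otimes> g" using h(1) by (auto simp: r_coset_def)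
  let ?C = "{g \<in> L. commutator z g \<in> N}"
  have zc: "z \<in> carrier G" using Q(1) z(1) sub_carrier by blast
  have C: "subgroup ?C G" by (rule relative_centralizer_subgroup[OF L N(1,3) zc])
  have kC: "k \<in> ?C" using k z(3) K by blast
  have hC: "h \<in> ?C" using h(2) k subgroup.m_closed[OF L subsetD[OF K(2) k(1)] g] by simp
  have c: "k \<in> carrier G" "g \<in> carrier G" using kC g sub_carrier[OF L] by blast+
  have "inv k \<otimes> h \<in> ?C" by (rule subgroup.m_closed[OF C subgroup.m_inv_closed[OF C kC] hC])
  moreover have "inv k \<otimes> h = g" using k c by simp
  ultimately show ?thesis by simp
qed

text \<open>
  An element of order prime to \<open>t\<close> acting trivially on the Frattini quotient of a \<open>t\<close>-group acts trivially,
  the Frattini quotient being expressed by characters: if the fixed points modulo \<open>N\<close> did not fill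
  \<open>L\<close>, they would lie in the kernel \<open>M\<close> of a character, while every coset of \<open>M\<close> contains a fixed point.
\<close>

lemma trivial_of_trivial_on_characters:
  assumes L: "subgroup L G" and N: "subgroup N G" "N \<subseteq> L" "normalizes L N"
    and Q: "subgroup Q G" "normalizes Q L" "normalizes Q N" "card Q = q ^ n"
    and q: "prime q" and t: "prime t" "t \<noteq> q" and cL: "card L = t ^ m * card N"
    and z: "z \<in> Q" "\<And>f g. mod_character t L f \<Longrightarrow> g \<in> L \<Longrightarrow> [f (conj_by z g) = f g] (mod int t)"
    and g: "g \<in> L"
  shows "commutator z g \<in> N"
proof -
  let ?C = "{g \<in> L. commutator z g \<in> N}"
  have zc: "z \<in> carrier G" using Q(1) z(1) sub_carrier by blast
  have C: "subgroup ?C G" by (rule relative_centralizer_subgroup[OF L N(1,3) zc])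
  have NC: "N \<subseteq> ?C"
  proof
    fix x assume x: "x \<in> N"
    have "conj_by z x \<in> N" using normalizesD[OF Q(3) z(1) x] .
    then have "commutator z x \<in> N"
      by (rule subgroup.m_closed[OF N(1) _ subgroup.m_inv_closed[OF N(1) x]])
    then show "x \<in> ?C" using x N by blast
  qed
  have "?C = L"
  proof (rule ccontr)
    assume "?C \<noteq> L"
    then obtain M where M: "subgroup M G" "?C \<subseteq> M" "M \<subseteq> L" "normalizes L M" "card L = t * card M"
      using normal_prime_index_over[OF L C _ _ N(1) NC N(3) t(1) cL] by auto
    obtain f where f: "mod_character t L f" "char_kernel t L f = M"
      using character_of_prime_index[OF L M(1,3,4) t(1) M(5)] by blast
    have zM: "commutator z h \<in> M" if h: "h \<in> L" for h
    proof -
      have zh: "conj_by z h \<in> L" using normalizesD[OF Q(2) z(1) h] .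
      have "int t dvd f (commutator z h)" using mod_character_div_iff[OF L f(1) zh h] z(2)[OF f(1) h] by blast
      moreover have "commutator z h \<in> L"
        by (rule subgroup.m_closed[OF L zh subgroup.m_inv_closed[OF L h]])
      ultimately have "commutator z h \<in> char_kernel t L f" by (simp add: char_kernel_def)
      then show ?thesis using f(2) by simp
    qed
    have NM: "N \<subseteq> M" using NC M(2) by blast
    obtain k where k: "card M = k * card N" using card_dvd[OF N(1) M(1) NM] by (metis dvd_div_mult_self)
    have "t ^ m = t * k" using M(5) k cL card_pos[OF N(1)] by simp
    then have "k dvd t ^ m" by simp
    then obtain j where j: "card M = t ^ j * card N" using k t divides_primepow_nat by metis
    have "L \<subseteq> M"
    proof
      fix x assume x: "x \<in> L"
      obtain h where h: "h \<in> M #> x" "commutator z h \<in> N"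
        using fixed_coset_lift[OF L M(1,3) N(1) NM N(3) Q q t j z(1) zM x] by blast
      obtain y where y: "y \<in> M" "h = y \<otimes> x" using h(1) by (auto simp: r_coset_def)
      have "y \<in> L" using y M by blast
      then have "h \<in> ?C" using h(2) y(2) subgroup.m_closed[OF L _ x] by simp
      then have "h \<in> M" using M by blast
      then have "inv y \<otimes> h \<in> M"
        by (rule subgroup.m_closed[OF M(1) subgroup.m_inv_closed[OF M(1) y(1)]])
      moreover have "inv y \<otimes> h = x" using y(2) \<open>y \<in> L\<close> x sub_carrier[OF L] by simp
      ultimately show "x \<in> M" by simp
    qed
    then have "M = L" using M by blast
    then have "t = 1" using M(5) card_pos[OF L] by simp
    then show False using t by simp
  qed
  then show ?thesis using g by blast
qed

section \<open>Chains of prime index and Sylow towers\<close>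

text \<open>
  The relation behind \<open>P\<close>-subnormality, with \<open>K\<close> in place of the whole group and stated by orders,
  so that no index or quotient occurs in inductions along a chain.
\<close>

inductive prime_chain :: "'a set \<Rightarrow> 'a set \<Rightarrow> bool" for H where
  base: "subgroup H G \<Longrightarrow> prime_chain H H"
| step: "prime_chain H K \<Longrightarrow> subgroup L G \<Longrightarrow> K \<subseteq> L \<Longrightarrow> prime p \<Longrightarrow> card L = p * card K \<Longrightarrow>
    prime_chain H L"

lemma prime_chain_subgroups:
  "prime_chain H K \<Longrightarrow> subgroup H G \<and> subgroup K G \<and> H \<subseteq> K"
  by (induction rule: prime_chain.induct) auto

lemma prime_chain_trans: "prime_chain K L \<Longrightarrow> prime_chain H K \<Longrightarrow> prime_chain H L"
  by (induction rule: prime_chain.induct) (auto intro: prime_chain.step)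

lemma card_subgroup_index:
  assumes "subgroup K G" "subgroup H G" "H \<subseteq> K"
  shows "subgroup_index G K H * card H = card K"
proof -
  interpret K: group "G\<lparr>carrier := K\<rparr>" using assms(1) by (rule subgroup_imp_group)
  show ?thesis
    using K.lagrange[OF subgroup_incl[OF assms(2,1,3)]] by (simp add: Coset.order_def subgroup_index_def)
qed

lemma prime_chain_of_P_subnormal:
  assumes A: "subgroup A G" and P: "P_subnormal P (G\<lparr>carrier := A\<rparr>)"
  shows "prime_chain P A"
proof -
  have sub: "subgroup P G" using P incl_subgroup[OF A] by (simp add: P_subnormal_def)
  have "P = A \<or> (\<exists>(n::nat) C. C 0 = P \<and> C n = A \<and>
      (\<forall>i\<le>n. subgroup (C i) (G\<lparr>carrier := A\<rparr>)) \<and>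
      (\<forall>i\<in>{1..n}. C (i - 1) \<subseteq> C i \<and>
        prime (subgroup_index (G\<lparr>carrier := A\<rparr>) (C i) (C (i - 1)))))"
    using P by (simp add: P_subnormal_def del: One_nat_def)
  then consider "P = A" | n C where "C 0 = P" "C (n::nat) = A"
    "\<forall>i\<le>n. subgroup (C i) (G\<lparr>carrier := A\<rparr>)"
    "\<forall>i\<in>{1..n}. C (i - 1) \<subseteq> C i \<and> prime (subgroup_index (G\<lparr>carrier := A\<rparr>) (C i) (C (i - 1)))"
    by (elim disjE exE conjE)
  then show ?thesis
  proof cases
    case 1
    then show ?thesis using prime_chain.base sub by blast
  next
    case (2 n C)
    have C: "subgroup (C i) G" if "i \<le> n" for i using 2(3) that incl_subgroup[OF A] by blast
    have "i \<le> n \<Longrightarrow> prime_chain P (C i)" for i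
    proof (induction i)
      case 0
      then show ?case using prime_chain.base sub 2(1) by simp
    next
      case (Suc i)
      have i: "Suc i \<in> {1..n}" using Suc.prems by simp
      have c: "C i \<subseteq> C (Suc i)" "prime (subgroup_index G (C (Suc i)) (C i))"
        using bspec[OF 2(4) i] by (simp_all add: subgroup_index_def)
      have "card (C (Suc i)) = subgroup_index G (C (Suc i)) (C i) * card (C i)"
        using card_subgroup_index[OF C C c(1)] Suc.prems by simp
      then show ?case using prime_chain.step[OF Suc.IH C[OF Suc.prems] c] Suc.prems by simp
    qed
    then show ?thesis using 2(2) by auto
  qed
qed

lemma P_subnormal_of_prime_chain:
  assumes "prime_chain H (carrier G)"
  shows "P_subnormal H G"
proof -
  have "\<exists>(n::nat) C. C 0 = H \<and> C n = K \<and> (\<forall>i\<le>n. subgroup (C i) G) \<and>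
      (\<forall>i\<in>{1..n}. C (i - 1) \<subseteq> C i \<and> prime (subgroup_index G (C i) (C (i - 1))))"
    if "prime_chain H K" for K
    using that
  proof (induction rule: prime_chain.induct)
    case base
    then show ?case by (intro exI[of _ 0] exI[of _ "\<lambda>_. H"]) simp
  next
    case (step K L p)
    then obtain n :: nat and C where C: "C 0 = H" "C n = K" "\<forall>i\<le>n. subgroup (C i) G"
      "\<forall>i\<in>{1..n}. C (i - 1) \<subseteq> C i \<and> prime (subgroup_index G (C i) (C (i - 1)))" by blast
    have K: "subgroup K G" using C(2,3) by blast
    have "subgroup_index G L K * card K = p * card K"
      using card_subgroup_index[OF step.hyps(2) K step.hyps(3)] step.hyps(5) by simp
    then have idx: "subgroup_index G L K = p" using card_pos[OF K] by simp
    define D where "D i = (if i \<le> n then C i else L)" for i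
    have "D 0 = H" "D (Suc n) = L" using C by (simp_all add: D_def)
    moreover have "\<forall>i\<le>Suc n. subgroup (D i) G" using C(3) step.hyps(2) by (simp add: D_def)
    moreover have "\<forall>i\<in>{1..Suc n}. D (i - 1) \<subseteq> D i \<and> prime (subgroup_index G (D i) (D (i - 1)))"
    proof
      fix i assume i: "i \<in> {1..Suc n}"
      show "D (i - 1) \<subseteq> D i \<and> prime (subgroup_index G (D i) (D (i - 1)))"
      proof (cases "i = Suc n")
        case True
        then show ?thesis using C(2) step.hyps(3,4) idx by (simp add: D_def)
      next
        case False
        then have "i \<in> {1..n}" "i - 1 \<le> n" using i by auto
        then show ?thesis using bspec[OF C(4), of i] by (simp add: D_def)
      qed
    qed
    ultimately show ?case by blast
  qed
  from this[OF assms] show ?thesis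
    using prime_chain_subgroups[OF assms] unfolding P_subnormal_def by blast
qed

text \<open>
  The index of \<open>H\<close> in \<open>K\<close> is the product of the indices of the images in \<open>K / (N \<inter> K)\<close> and of the
  intersections with \<open>N\<close>.  If it is prime, one of the two inclusions is an equality and the other has
  prime index: chains survive multiplication by and intersection with a normal subgroup.
\<close>

lemma index_split:
  assumes N: "subgroup N G" and H: "subgroup H G" and K: "subgroup K G" "H \<subseteq> K"
    and nrm: "normalizes K N" and c: "card K = p * card H"
  shows "\<exists>a b. p = a * b \<and> card (N <#> K) = a * card (N <#> H) \<and> card (N \<inter> K) = b * card (N \<inter> H)"
proof -
  have nH: "normalizes H N" using normalizes_mono[OF nrm K(2)] .
  have s: "subgroup (N <#> H) G" "subgroup (N <#> K) G" "subgroup (N \<inter> H) G" "subgroup (N \<inter> K) G"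
    using subgroup_set_mult N H K(1) nrm nH subgroup_Int by auto
  have "N <#> H \<subseteq> N <#> K" using K(2) by (auto simp: set_mult_def)
  then obtain a where a: "card (N <#> K) = a * card (N <#> H)"
    using card_dvd[OF s(1,2)] by (metis dvd_div_mult_self)
  have "N \<inter> H \<subseteq> N \<inter> K" using K(2) by blast
  then obtain b where b: "card (N \<inter> K) = b * card (N \<inter> H)"
    using card_dvd[OF s(3,4)] by (metis dvd_div_mult_self)
  have e1: "card (N <#> K) * card (N \<inter> K) = card N * (p * card H)"
    using card_set_mult[OF N K(1)] c by simp
  have e2: "card (N <#> H) * card (N \<inter> H) = card N * card H" by (rule card_set_mult[OF N H])
  have "(a * b) * (card (N <#> H) * card (N \<inter> H)) = card (N <#> K) * card (N \<inter> K)"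
    unfolding a b by (simp add: mult_ac)
  also have "\<dots> = p * (card (N <#> H) * card (N \<inter> H))" unfolding e1 e2 by (simp add: mult_ac)
  finally have "a * b = p" using card_pos[OF s(1)] card_pos[OF s(3)] by simp
  then show ?thesis using a b by blast
qed

lemma prime_chain_set_mult:
  assumes N: "subgroup N G" and c: "prime_chain H K" and nrm: "normalizes K N"
  shows "prime_chain (N <#> H) (N <#> K)"
  using c nrm
proof (induction rule: prime_chain.induct)
  case base
  then show ?case using prime_chain.base subgroup_set_mult N by blast
next
  case (step K L p)
  have K: "subgroup K G" "prime_chain (N <#> H) (N <#> K)"
    using step.IH step.hyps normalizes_mono[OF step.prems] prime_chain_subgroups by blast+
  have sL: "subgroup (N <#> L) G" using subgroup_set_mult N step by blast
  have KL: "N <#> K \<subseteq> N <#> L" using step by (auto simp: set_mult_def)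
  obtain a b where ab: "p = a * b" "card (N <#> L) = a * card (N <#> K)"
    using index_split[OF N K(1) step.hyps(2,3) step.prems step.hyps(5)] by blast
  then have "a = 1 \<or> a = p" using step.hyps(4) by (metis dvd_triv_left prime_nat_iff)
  then show ?case
  proof
    assume "a = 1"
    then have "N <#> K = N <#> L" using ab card_subset_eq[OF sub_finite[OF sL] KL] by simp
    then show ?thesis using K by simp
  next
    assume "a = p"
    then show ?thesis using prime_chain.step[OF K(2) sL KL step.hyps(4)] ab by simp
  qed
qed

lemma prime_chain_conj:
  assumes x: "x \<in> carrier G" and c: "prime_chain H K"
  shows "prime_chain (conj_by x ` H) (conj_by x ` K)"
  using c
proof (induction rule: prime_chain.induct)
  case base
  then show ?case using prime_chain.base conj_by_subgroup x by blast
next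
  case (step K L p)
  then show ?case
    using prime_chain.step[OF step.IH conj_by_subgroup[OF x step.hyps(2)] image_mono[OF step.hyps(3)] step.hyps(4)]
      card_conj_by[OF x] prime_chain_subgroups[OF step.hyps(1)] by simp
qed

text \<open>
  The terms of a Sylow tower: normal Hall subgroups for the primes \<open>\<ge> n\<close>.
\<close>

definition upper_hall :: "nat \<Rightarrow> 'a set \<Rightarrow> 'a set \<Rightarrow> bool" where
  "upper_hall n A L \<longleftrightarrow> subgroup L G \<and> L \<subseteq> A \<and> normalizes A L \<and>
     (\<forall>p. prime p \<and> p dvd card L \<longrightarrow> n \<le> p) \<and>
     (\<forall>p. prime p \<and> p dvd card A div card L \<longrightarrow> p < n)"

lemma upper_hallD:
  assumes "upper_hall n A L"
  shows "subgroup L G" "L \<subseteq> A" "normalizes A L"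
    "\<And>p. prime p \<Longrightarrow> p dvd card L \<Longrightarrow> n \<le> p"
    "\<And>p. prime p \<Longrightarrow> p dvd card A div card L \<Longrightarrow> p < n"
  using assms by (auto simp: upper_hall_def)

lemma upper_hall_contains:
  assumes A: "subgroup A G" and L: "upper_hall n A L" and X: "subgroup X G" "X \<subseteq> A"
    and big: "\<And>p. prime p \<Longrightarrow> p dvd card X \<Longrightarrow> n \<le> p"
  shows "X \<subseteq> L"
proof -
  note h = upper_hallD[OF L]
  have nX: "normalizes X L" using normalizes_mono[OF h(3) X(2)] .
  have s: "subgroup (L <#> X) G" using subgroup_set_mult h(1) X(1) nX by blast
  have LX: "L \<subseteq> L <#> X" "X \<subseteq> L <#> X" "L <#> X \<subseteq> A"
    using set_mult_upper1[OF X(1) subgroup.subset[OF h(1)]] set_mult_upper2[OF h(1) subgroup.subset[OF X(1)]]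
      set_mult_least[OF A h(2) X(2)] by auto
  obtain a where a: "card (L <#> X) = a * card L" using card_dvd[OF h(1) s LX(1)] by (metis dvd_div_mult_self)
  have "a * card (L \<inter> X) * card L = card X * card L"
    using card_set_mult[OF h(1) X(1)] a by (simp add: mult_ac)
  then have "a * card (L \<inter> X) = card X" using card_pos[OF h(1)] by simp
  then have aX: "a dvd card X" by (metis dvd_triv_left)
  obtain d where d: "card A = d * card (L <#> X)" using card_dvd[OF s A LX(3)] by (metis dvd_div_mult_self)
  have "card A div card L = d * a" unfolding d a using card_pos[OF h(1)] by (simp add: mult.assoc[symmetric])
  then have aA: "a dvd card A div card L" by simp
  have "a = 1"
  proof (rule ccontr)
    assume "a \<noteq> 1"
    then obtain p where p: "prime p" "p dvd a" using prime_factor_nat by blast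
    then have "n \<le> p" "p < n" using big h(5) aX aA dvd_trans by blast+
    then show False by simp
  qed
  then have "L = L <#> X" using a card_subset_eq[OF sub_finite[OF s] LX(1)] by simp
  then show ?thesis using LX(2) by simp
qed

lemma upper_hall_invariant:
  assumes A: "subgroup A G" and L: "upper_hall n A L" and X: "X \<subseteq> carrier G" "normalizes X A"
  shows "normalizes X L"
  unfolding normalizes_def
proof (intro ballI)
  fix x l assume x: "x \<in> X" and l: "l \<in> L"
  note h = upper_hallD[OF L]
  have xc: "x \<in> carrier G" using x X by blast
  have "conj_by x ` L \<subseteq> L"
  proof (rule upper_hall_contains[OF A L conj_by_subgroup[OF xc h(1)]])
    show "conj_by x ` L \<subseteq> A" using h(2) normalizesD[OF X(2) x] by blast
    show "n \<le> p" if "prime p" "p dvd card (conj_by x ` L)" for p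
      using that h(4) card_conj_by[OF xc h(1)] by simp
  qed
  then show "conj_by x l \<in> L" using l by blast
qed

text \<open>
  Let \<open>L = N T\<close>.  Along the chain \<open>N K\<close>, with \<open>K\<close> running from \<open>T\<close> to \<open>A\<close>, the subgroup \<open>L\<close> stays normal: each
  index \<open>a\<close> is \<open>1\<close> or a prime below \<open>t\<close>, so for a conjugate \<open>J\<^sup>w\<close> of the previous term \<open>J\<close> the index
  \<open>|L : L \<inter> J\<^sup>w| \<le> a\<close> is smaller than \<open>t\<close>, but a divisor of \<open>|L|\<close>, whose prime factors are \<open>\<ge> t\<close>.
  Hence \<open>L\<close> lies in all conjugates of \<open>J\<close>, and being a normal Hall subgroup of \<open>J\<close> it is invariant.
\<close>

lemma upper_hall_step:
  assumes A: "subgroup A G" and t: "prime t" and N: "upper_hall (Suc t) A N"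
    and T: "subgroup T G" "card T = t ^ multiplicity t (card A)" and chain: "prime_chain T A"
  shows "upper_hall t A (N <#> T)" "card (N <#> T) = t ^ multiplicity t (card A) * card N"
proof -
  define L where "L = N <#> T"
  note h = upper_hallD[OF N]
  have TA: "T \<subseteq> A" using prime_chain_subgroups[OF chain] by blast
  have nT: "normalizes T N" using normalizes_mono[OF h(3) TA] .
  have L: "subgroup L G" unfolding L_def using subgroup_set_mult h(1) T(1) nT by blast
  have LA: "L \<subseteq> A" unfolding L_def using set_mult_least[OF A h(2) TA] .
  have NL: "N \<subseteq> L" unfolding L_def using set_mult_upper1[OF T(1) subgroup.subset[OF h(1)]] .
  define m where "m = multiplicity t (card A)"
  have Tm: "card T = t ^ m" using T(2) by (simp add: m_def)
  have "\<not> t dvd card N" using h(4)[OF t] by auto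
  then have cop: "coprime (card N) (card T)"
    unfolding Tm using t by (simp add: prime_imp_coprime coprime_commute)
  have "card (N \<inter> T) dvd card N" "card (N \<inter> T) dvd card T"
    using card_dvd[OF subgroup_Int[OF h(1) T(1)]] h(1) T(1) by auto
  then have "card (N \<inter> T) = 1" using cop by (metis coprime_common_divisor_nat coprime_commute)
  then have cL: "card L = t ^ m * card N"
    using card_set_mult[OF h(1) T(1)] Tm by (simp add: L_def mult.commute)
  have big: "t \<le> p" if p: "prime p" "p dvd card L" for p
  proof -
    have "p dvd t ^ m \<or> p dvd card N" using p cL by (simp add: prime_dvd_mult_iff)
    then show ?thesis using h(4)[OF p(1)] p(1) t by (metis Suc_leD order_refl prime_dvd_power primes_dvd_imp_eq)
  qed
  obtain e where e: "card A = e * card L" using card_dvd[OF L A LA] by (metis dvd_div_mult_self)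
  have small: "p < t" if p: "prime p" "p dvd e" for p
  proof -
    have "card A div card N = e * t ^ m" unfolding e cL using card_pos[OF h(1)] by simp
    then have "p < Suc t" using h(5)[OF p(1)] p(2) by simp
    moreover have "p \<noteq> t"
    proof
      assume "p = t"
      then obtain e' where "e = t * e'" using p(2) by auto
      then have "card A = t ^ Suc m * (e' * card N)" using e cL by (simp add: mult_ac)
      then have "t ^ Suc m dvd card A" by simp
      then have "Suc m \<le> m"
        unfolding m_def using t card_pos[OF A] by (intro multiplicity_geI) (auto simp: m_def)
      then show False by simp
    qed
    ultimately show ?thesis by simp
  qed
  have key: "normalizes (N <#> K) L" if "prime_chain T K" "K \<subseteq> A" for K
    using that
  proof (induction rule: prime_chain.induct)
    case base
    then show ?case using normalizes_self[OF L] by (simp add: L_def)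
  next
    case (step K K' p)
    define J where "J = N <#> K"
    define J' where "J' = N <#> K'"
    have K: "subgroup K G" "T \<subseteq> K" using prime_chain_subgroups step.hyps(1) by blast+
    have KA: "K \<subseteq> A" using step by blast
    have nK: "normalizes K N" "normalizes K' N" using normalizes_mono[OF h(3)] KA step.prems by blast+
    have J: "subgroup J G" "subgroup J' G"
      unfolding J_def J'_def using subgroup_set_mult h(1) K(1) step.hyps(2) nK by blast+
    have LJ: "L \<subseteq> J" using K(2) by (auto simp: L_def J_def set_mult_def)
    have JJ': "J \<subseteq> J'" using step.hyps(3) by (auto simp: J_def J'_def set_mult_def)
    have J'A: "J' \<subseteq> A" unfolding J'_def using set_mult_least[OF A h(2) step.prems] .
    have IH: "normalizes J L" using step.IH KA by (simp add: J_def)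
    obtain a b where ab: "p = a * b" "card J' = a * card J"
      using index_split[OF h(1) K(1) step.hyps(2,3) nK(2) step.hyps(5)] unfolding J_def J'_def by blast
    obtain y where y: "card J = y * card L" using card_dvd[OF L J(1) LJ] by (metis dvd_div_mult_self)
    obtain x where x: "card A = x * card J'" using card_dvd[OF J(2) A J'A] by (metis dvd_div_mult_self)
    have "card A = x * a * y * card L" unfolding x ab(2) y by simp
    then have "e * card L = x * a * y * card L" unfolding e .
    then have exy: "e = x * a * y" using card_pos[OF L] mult_right_cancel[of "card L" e] by blast
    have a: "a = 1 \<or> a = p" using ab step.hyps(4) by (metis dvd_triv_left prime_nat_iff)
    have at: "a < t"
    proof (cases "a = 1")
      case True
      then show ?thesis using t prime_gt_1_nat by simp
    next
      case False
      then show ?thesis using a small[of p] step.hyps(4) exy by simp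
    qed
    have LJhall: "upper_hall t J L"
      unfolding upper_hall_def
    proof (intro conjI allI impI)
      show "p < t" if "prime p \<and> p dvd card J div card L" for p
        using that small[of p] exy y card_pos[OF L] by simp
    qed (use L LJ IH big in auto)
    show ?case
      unfolding J'_def[symmetric] normalizes_def
    proof (intro ballI)
      fix x l assume x: "x \<in> J'" and l: "l \<in> L"
      \<comment> \<open>The conjugate of \<open>J\<close> to be considered is the one by \<open>x\<^sup>-\<^sup>1\<close>, since \<open>x L x\<^sup>-\<^sup>1 \<subseteq> J\<close> is wanted.\<close>
      define w where "w = inv x"
      have w: "w \<in> J'" using x subgroup.m_inv_closed[OF J(2)] by (simp add: w_def)
      have xc: "x \<in> carrier G" "w \<in> carrier G" using x w sub_carrier[OF J(2)] by blast+
      have wJ: "subgroup (conj_by w ` J) G" by (rule conj_by_subgroup[OF xc(2) J(1)])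
      have wJ': "conj_by w ` J \<subseteq> J'"
        using normalizesD[OF normalizes_self[OF J(2)] w] JJ' by blast
      let ?D = "L \<inter> conj_by w ` J"
      have D: "subgroup ?D G" using subgroup_Int[OF L wJ] .
      obtain b where b: "card L = b * card ?D" using card_dvd[OF D L] by (metis Int_lower1 dvd_div_mult_self)
      have "card (L <#> conj_by w ` J) * card ?D = b * card (conj_by w ` J) * card ?D"
        using card_set_mult[OF L wJ] b by (simp add: mult_ac)
      then have "card (L <#> conj_by w ` J) = b * card (conj_by w ` J)" using card_pos[OF D] by simp
      moreover have "L <#> conj_by w ` J \<subseteq> J'" using set_mult_least[OF J(2) _ wJ'] LJ JJ' by blast
      ultimately have "b * card (conj_by w ` J) \<le> card J'" using card_mono[OF sub_finite[OF J(2)]] by metis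
      then have "b * card J \<le> a * card J" using ab card_conj_by[OF xc(2) J(1)] by simp
      then have bt: "b < t" using at card_pos[OF J(1)] by simp
      have "b = 1"
      proof (rule ccontr)
        assume "b \<noteq> 1"
        then obtain r where r: "prime r" "r dvd b" using prime_factor_nat by blast
        have "b > 0" using b card_pos[OF L] by (cases b) auto
        then have "r \<le> b" using r dvd_imp_le by blast
        moreover have "t \<le> r" using big[OF r(1)] r(2) b by simp
        ultimately show False using bt by simp
      qed
      then have "?D = L" using b card_subset_eq[OF sub_finite[OF L], of ?D] by simp
      then have LwJ: "L \<subseteq> conj_by w ` J" by blast
      have "conj_by x ` L \<subseteq> J"
      proof
        fix u assume "u \<in> conj_by x ` L"
        then obtain v where v: "v \<in> L" "u = conj_by x v" by blast
        then obtain j where j: "j \<in> J" "v = conj_by w j" using LwJ by blast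
        then have "u = j" using v xc sub_carrier[OF J(1) j(1)] by (simp add: w_def)
        then show "u \<in> J" using j by simp
      qed
      then have "conj_by x ` L \<subseteq> L"
        using upper_hall_contains[OF J(1) LJhall conj_by_subgroup[OF xc(1) L]] big card_conj_by[OF xc(1) L] by simp
      then show "conj_by x l \<in> L" using l by blast
    qed
  qed
  have "N <#> A = A"
    using set_mult_least[OF A h(2)] set_mult_upper2[OF h(1) subgroup.subset[OF A]] by blast
  then have "normalizes A L" using key[OF chain] by simp
  then show "upper_hall t A (N <#> T)"
    using L LA big small e card_pos[OF L] by (simp add: upper_hall_def L_def[symmetric])
  show "card (N <#> T) = t ^ multiplicity t (card A) * card N" using cL by (simp add: L_def m_def)
qed

section \<open>The action on one step of the tower\<close>

lemma mod_character_trivial_on_coprime: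
  assumes L: "subgroup L G" and f: "mod_character t L f" and N: "subgroup N G" "coprime t (card N)"
    and n: "n \<in> L" "n \<in> N"
  shows "int t dvd f n"
  using mod_character_coprime_order[OF L f n(1) pow_card_eq_one[OF N(1) n(2)]] N(2)
  by (simp add: coprime_commute)

text \<open>
  The kernel of a common eigenvector among the characters of \<open>L\<close> is a \<open>Q\<close>-invariant subgroup of index \<open>t\<close>
  containing \<open>N\<close>, and inherits all hypotheses.  The set \<open>S\<close> generates \<open>Q\<close> in the weak sense that
  invariance under \<open>S\<close> implies invariance under \<open>Q\<close>; only its elements have to be simultaneously
  diagonalized.
\<close>

lemma prime_chain_of_commuting_action:
  assumes N: "subgroup N G" and cop: "coprime t (card N)"
    and Q: "subgroup Q G" "card Q = q ^ n" "normalizes Q N" and q: "prime q" and t: "prime t" "t \<noteq> q"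
    and S: "S \<subseteq> Q" "\<And>H. subgroup H G \<Longrightarrow> normalizes S H \<Longrightarrow> normalizes Q H"
  shows "subgroup L G \<Longrightarrow> N \<subseteq> L \<Longrightarrow> normalizes L N \<Longrightarrow> normalizes Q L \<Longrightarrow> card L = t ^ m * card N \<Longrightarrow>
    (\<And>x g. x \<in> S \<Longrightarrow> g \<in> L \<Longrightarrow> commutator (x [^] (t - 1)) g \<in> N) \<Longrightarrow>
    (\<And>x y g. x \<in> S \<Longrightarrow> y \<in> S \<Longrightarrow> g \<in> L \<Longrightarrow> commutator (commutator x y) g \<in> N) \<Longrightarrow>
    prime_chain (N <#> Q) (L <#> Q)"
proof (induction m arbitrary: L)
  case 0
  then have "N = L" using card_subset_eq[OF sub_finite[OF 0(1)]] by simp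
  then show ?case using prime_chain.base subgroup_set_mult[OF N Q(1,3)] by simp
next
  case (Suc m)
  note L = Suc.prems(1)
  have Sc: "x \<in> carrier G" if "x \<in> S" for x using that S(1) sub_carrier[OF Q(1)] by blast
  have SL: "normalizes {x} L" if "x \<in> S" for x using that S(1) normalizes_mono[OF Suc.prems(4)] by blast
  have Lc: "g \<in> carrier G" if "g \<in> L" for g using that sub_carrier[OF L] by blast
  have "N \<noteq> L"
  proof
    assume "N = L"
    then have "t ^ Suc m = 1" using Suc.prems(5) card_pos[OF N] by simp
    then show False using t(1) by (metis nat.distinct(1) nat_power_eq_Suc_0_iff One_nat_def not_prime_1)
  qed
  then obtain M where M: "subgroup M G" "N \<subseteq> M" "M \<subseteq> L" "normalizes L M" "card L = t * card M"
    using normal_prime_index_over[OF L N Suc.prems(2) _ N subset_refl Suc.prems(3) t(1) Suc.prems(5)] by blast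
  obtain f0 where f0: "mod_character t L f0" "char_kernel t L f0 = M"
    using character_of_prime_index[OF L M(1,3,4) t(1) M(5)] by blast
  have nt0: "\<exists>g\<in>L. \<not> int t dvd f0 g"
  proof (rule ccontr)
    assume "\<not> ?thesis"
    then have "M = L" using f0(2) by (auto simp: char_kernel_def)
    then have "t = 1" using M(5) card_pos[OF L] by simp
    then show False using t(1) by simp
  qed
  have triv: "[f (conj_by z g) = f g] (mod int t)"
    if f: "mod_character t L f" and g: "g \<in> L" and zg: "conj_by z g \<in> L" and z: "commutator z g \<in> N" for f z g
  proof -
    have "commutator z g \<in> L" by (rule subgroup.m_closed[OF L zg subgroup.m_inv_closed[OF L g]])
    then have "int t dvd f (commutator z g)"
      using mod_character_trivial_on_coprime[OF L f N cop _ z] by blast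
    then show ?thesis using mod_character_div_iff[OF L f zg g] by blast
  qed
  have "finite (conj_by ` S)" using sub_finite[OF Q(1)] S(1) finite_subset by blast
  then have "\<exists>w. mod_character t L w \<and> (\<exists>g\<in>L. \<not> int t dvd w g) \<and>
      (\<forall>\<sigma>\<in>conj_by ` S. \<exists>k. \<forall>g\<in>L. [w (\<sigma> g) = k * w g] (mod int t))"
  proof (rule common_eigenfunction_exists[where F = "mod_character t L" and f = f0, OF t(1)])
    show "mod_character t L f0" "\<exists>g\<in>L. \<not> int t dvd f0 g" by fact+
    show "mod_character t L (\<lambda>g. f (\<sigma> g) - k * f g)" if f: "mod_character t L f" and \<sigma>: "\<sigma> \<in> conj_by ` S" for f k \<sigma>
      unfolding mod_character_def
    proof (intro ballI)
      fix g h assume gh: "g \<in> L" "h \<in> L"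
      obtain x where x: "x \<in> S" "\<sigma> = conj_by x" using \<sigma> by blast
      have "[f (conj_by x g \<otimes> conj_by x h) - k * f (g \<otimes> h) = (f (conj_by x g) + f (conj_by x h)) - k * (f g + f h)] (mod int t)"
        using normalizesD[OF SL[OF x(1)]] gh
        by (intro cong_diff cong_scalar_left mod_character_mult[OF L f]) auto
      moreover have "\<sigma> (g \<otimes> h) = conj_by x g \<otimes> conj_by x h" using x Sc gh Lc by (simp add: conj_by_mult)
      ultimately show "[f (\<sigma> (g \<otimes> h)) - k * f (g \<otimes> h) = f (\<sigma> g) - k * f g + (f (\<sigma> h) - k * f h)] (mod int t)"
        using x by (simp add: algebra_simps)
    qed
    show "\<sigma> g \<in> L" if "\<sigma> \<in> conj_by ` S" "g \<in> L" for \<sigma> g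
      using that SL by (auto simp: normalizes_def)
    show "[f ((\<sigma> ^^ (t - 1)) g) = f g] (mod int t)"
      if f: "mod_character t L f" and \<sigma>: "\<sigma> \<in> conj_by ` S" and g: "g \<in> L" for f g \<sigma>
    proof -
      obtain x where x: "x \<in> S" "\<sigma> = conj_by x" using \<sigma> by blast
      have e: "(\<sigma> ^^ (t - 1)) g = conj_by (x [^] (t - 1)) g" using conj_by_pow[OF Sc[OF x(1)] Lc[OF g]] x by simp
      have "x [^] (t - 1) \<in> Q" using pow_mem[OF Q(1)] x S by blast
      then have "conj_by (x [^] (t - 1)) g \<in> L" using normalizesD[OF Suc.prems(4)] g by blast
      then show ?thesis unfolding e using triv[OF f g] Suc.prems(6)[OF x(1) g] by blast
    qed
    show "[f (\<sigma> (\<tau> g)) = f (\<tau> (\<sigma> g))] (mod int t)"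
      if f: "mod_character t L f" and \<sigma>: "\<sigma> \<in> conj_by ` S" and \<tau>: "\<tau> \<in> conj_by ` S" and g: "g \<in> L" for f g \<sigma> \<tau>
    proof -
      obtain x y where xy: "x \<in> S" "\<sigma> = conj_by x" "y \<in> S" "\<tau> = conj_by y" using \<sigma> \<tau> by blast
      show ?thesis unfolding xy(2,4)
      proof (rule values_commute[OF L f _ Sc[OF xy(1)] SL[OF xy(1)] Sc[OF xy(3)] SL[OF xy(3)] _ g])
        show "int t dvd f n" if "n \<in> L" "n \<in> N" for n
          using mod_character_trivial_on_coprime[OF L f N cop that] .
        show "commutator (commutator x y) g \<in> N" if "g \<in> L" for g
          using Suc.prems(7)[OF xy(1,3) that] .
      qed
    qed
  qed
  then obtain f where f: "mod_character t L f" and nt: "\<exists>g\<in>L. \<not> int t dvd f g"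
    and ev: "\<And>x. x \<in> S \<Longrightarrow> \<exists>k. \<forall>g\<in>L. [f (conj_by x g) = k * f g] (mod int t)" by blast
  define K where "K = char_kernel t L f"
  have K: "subgroup K G" unfolding K_def by (rule char_kernel_subgroup[OF L f])
  have cK: "card L = t * card K" unfolding K_def by (rule card_char_kernel[OF L f t(1) nt])
  have KL: "K \<subseteq> L" by (auto simp: K_def char_kernel_def)
  have NK: "N \<subseteq> K"
    using mod_character_trivial_on_coprime[OF L f N cop] Suc.prems(2) by (auto simp: K_def char_kernel_def)
  have "normalizes S K"
    unfolding normalizes_def
  proof (intro ballI)
    fix x g assume x: "x \<in> S" and g: "g \<in> K"
    obtain k where k: "\<forall>g\<in>L. [f (conj_by x g) = k * f g] (mod int t)" using ev[OF x] by blast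
    have gL: "g \<in> L" "int t dvd f g" using g by (auto simp: K_def char_kernel_def)
    have "int t dvd k * f g" using gL(2) by simp
    then have "int t dvd f (conj_by x g)" using cong_dvd_iff[OF bspec[OF k gL(1)]] by blast
    then show "conj_by x g \<in> K" using normalizesD[OF SL[OF x]] gL by (simp add: K_def char_kernel_def)
  qed
  then have QK: "normalizes Q K" using S(2) K by blast
  have IH: "prime_chain (N <#> Q) (K <#> Q)"
  proof (rule Suc.IH[OF K NK _ QK])
    show "normalizes K N" using normalizes_mono[OF Suc.prems(3) KL] .
    show "card K = t ^ m * card N" using cK Suc.prems(5) prime_gt_0_nat[OF t(1)] by simp
  qed (use Suc.prems(6,7) KL in blast)+
  have "L \<inter> Q = K \<inter> Q"
  proof
    show "K \<inter> Q \<subseteq> L \<inter> Q" using KL by blast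
    have "coprime t (card Q)" unfolding Q(2) using t q by (simp add: primes_coprime)
    then show "L \<inter> Q \<subseteq> K \<inter> Q"
      using mod_character_trivial_on_coprime[OF L f Q(1)] by (auto simp: K_def char_kernel_def)
  qed
  then have "card (L <#> Q) * card (K \<inter> Q) = t * card (K <#> Q) * card (K \<inter> Q)"
    using card_set_mult[OF L Q(1)] card_set_mult[OF K Q(1)] cK by simp
  then have c: "card (L <#> Q) = t * card (K <#> Q)" using card_pos[OF subgroup_Int[OF K Q(1)]] by simp
  have "K <#> Q \<subseteq> L <#> Q" using KL by (auto simp: set_mult_def)
  then show ?case using prime_chain.step[OF IH subgroup_set_mult[OF L Q(1) Suc.prems(4)] _ t(1) c] by blast
qed

text \<open>
  Let \<open>K\<close> run through a chain of prime index from \<open>P\<close> to \<open>A\<close>.  The groups \<open>L \<inter> N K\<close> form a series from \<open>N\<close>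
  to \<open>L\<close>; they are normalized by \<open>P\<close> because \<open>P \<subseteq> K\<close>, and consecutive ones are equal or have index
  \<open>t\<close>.  On a factor of order \<open>t\<close> the group \<open>P\<close> acts by scalars, so \<open>z\<close> acts trivially on it, and
  coprime action collects the factors.
\<close>

lemma sylow_commutators_trivial:
  assumes A: "subgroup A G" and P: "subgroup P G" "card P = q ^ n" "prime_chain P A"
    and q: "prime q" and t: "prime t" "t \<noteq> q"
    and N: "subgroup N G" "N \<subseteq> A" "normalizes A N" and L: "subgroup L G" "L \<subseteq> A" "normalizes A L" "N \<subseteq> L"
    and cL: "card L = t ^ m * card N" and cop: "coprime t (card N)"
    and z: "(\<exists>x\<in>P. z = x [^] (t - 1)) \<or> (\<exists>x\<in>P. \<exists>y\<in>P. z = commutator x y)" and g: "g \<in> L"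
  shows "commutator z g \<in> N"
proof -
  have PA: "P \<subseteq> A" using prime_chain_subgroups[OF P(3)] by blast
  have Pc: "x \<in> carrier G" if "x \<in> P" for x using that sub_carrier[OF P(1)] by blast
  have zP: "z \<in> P"
    using z pow_mem[OF P(1)] normalizesD[OF normalizes_self[OF P(1)]]
      subgroup.m_closed[OF P(1)] subgroup.m_inv_closed[OF P(1)] by blast
  have NA: "N <#> K \<subseteq> A" if "K \<subseteq> A" for K using set_mult_least[OF A N(2) that] .
  have nK: "normalizes K N" if "K \<subseteq> A" for K using normalizes_mono[OF N(3) that] .
  have key: "\<forall>h\<in>L \<inter> (N <#> K). commutator z h \<in> N" if "prime_chain P K" "K \<subseteq> A" for K
    using that
  proof (induction rule: prime_chain.induct)
    case base
    have NP: "subgroup (N <#> P) G" using subgroup_set_mult[OF N(1) P(1) nK[OF PA]] .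
    \<comment> \<open>The index of \<open>N\<close> in \<open>L \<inter> N P\<close> divides both \<open>|L : N|\<close>, a power of \<open>t\<close>, and \<open>|N P : N|\<close>, a power of \<open>q\<close>.\<close>
    let ?J = "L \<inter> (N <#> P)"
    have J: "subgroup ?J G" using subgroup_Int[OF L(1) NP] .
    have NJ: "N \<subseteq> ?J" using L(4) set_mult_upper1[OF P(1) subgroup.subset[OF N(1)]] by blast
    obtain c where c: "card ?J = c * card N" using card_dvd[OF N(1) J NJ] by (metis dvd_div_mult_self)
    have "card ?J dvd card L" using card_dvd[OF J L(1)] by blast
    then have c1: "c dvd t ^ m" unfolding c cL using card_pos[OF N(1)] by simp
    obtain d where d: "card (N <#> P) = d * card N"
      using card_dvd[OF N(1) NP] NJ by (metis Int_subset_iff dvd_div_mult_self)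
    have "d * card (N \<inter> P) * card N = card P * card N" using card_set_mult[OF N(1) P(1)] d by (simp add: mult_ac)
    then have "d * card (N \<inter> P) = q ^ n" using card_pos[OF N(1)] P(2) by simp
    then have d1: "d dvd q ^ n" by (metis dvd_triv_left)
    have "card ?J dvd card (N <#> P)" using card_dvd[OF J NP] by blast
    then have "c dvd d" unfolding c d using card_pos[OF N(1)] by simp
    then have "c dvd q ^ n" using d1 dvd_trans by blast
    moreover have "coprime (t ^ m) (q ^ n)" using t q by (simp add: primes_coprime)
    ultimately have "c = 1" using c1 by (metis coprime_common_divisor_nat)
    then have "N = ?J" using card_subset_eq[OF sub_finite[OF J] NJ] c by simp
    moreover have "commutator z h \<in> N" if h: "h \<in> N" for h
      by (rule subgroup.m_closed[OF N(1) normalizesD[OF nK[OF PA] zP h] subgroup.m_inv_closed[OF N(1) h]])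
    ultimately show ?case by blast
  next
    case (step K K' p)
    have K: "subgroup K G" "P \<subseteq> K" using prime_chain_subgroups[OF step.hyps(1)] by blast+
    have KA: "K \<subseteq> A" using step by blast
    let ?NK = "N <#> K" and ?NK' = "N <#> K'"
    have s: "subgroup ?NK G" "subgroup ?NK' G"
      using subgroup_set_mult[OF N(1) K(1) nK[OF KA]] subgroup_set_mult[OF N(1) step.hyps(2) nK[OF step.prems]] by blast+
    have NKsub: "?NK \<subseteq> ?NK'" using step.hyps(3) by (auto simp: set_mult_def)
    obtain a b where ab: "p = a * b" "card ?NK' = a * card ?NK"
      using index_split[OF N(1) K(1) step.hyps(2,3) nK[OF step.prems] step.hyps(5)] by blast
    define J where "J = L \<inter> ?NK"
    define J' where "J' = L \<inter> ?NK'"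
    have nL: "normalizes ?NK' L" using normalizes_mono[OF L(3) NA[OF step.prems]] .
    obtain u v where uv: "a = u * v" "card J' = v * card J"
      using index_split[OF L(1) s(1) s(2) NKsub nL ab(2)] unfolding J_def J'_def by blast
    have J: "subgroup J G" "subgroup J' G" unfolding J_def J'_def using subgroup_Int[OF L(1)] s by blast+
    have JJ': "J \<subseteq> J'" using NKsub by (auto simp: J_def J'_def)
    have IH: "\<forall>h\<in>J. commutator z h \<in> N" using step.IH KA by (simp add: J_def)
    have "v dvd p" using ab uv by simp
    then have "v = 1 \<or> v = p" using step.hyps(4) by (metis prime_nat_iff)
    then show ?case
    proof
      assume "v = 1"
      then have "J = J'" using uv card_subset_eq[OF sub_finite[OF J(2)] JJ'] by simp
      then show ?thesis using IH by (simp add: J'_def)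
    next
      assume vp: "v = p"
      have NJ: "N \<subseteq> J" using L(4) set_mult_upper1[OF K(1) subgroup.subset[OF N(1)]] by (auto simp: J_def)
      obtain y where y: "card J = y * card N" using card_dvd[OF N(1) J(1) NJ] by (metis dvd_div_mult_self)
      have "card J' dvd card L" using card_dvd[OF J(2) L(1)] by (auto simp: J'_def)
      then have "p * y * card N dvd t ^ m * card N" using uv vp y cL by simp
      then have py: "p * y dvd t ^ m" using card_pos[OF N(1)] by simp
      then have "p dvd t ^ m" "y dvd t ^ m" by (auto elim: dvd_mult_left dvd_mult_right)
      then have pt: "p = t" using step.hyps(4) t by (metis prime_dvd_power primes_dvd_imp_eq)
      obtain j where j: "y = t ^ j" using \<open>y dvd t ^ m\<close> t(1) divides_primepow_nat by blast
      have cJ': "card J' = t * card J" using uv vp pt by simp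
      have cJN: "card J' = t ^ Suc j * card N" using cJ' y j by simp
      have J'L: "J' \<subseteq> L" by (auto simp: J'_def)
      have nJN: "normalizes J' N" using normalizes_mono[OF N(3)] J'L L(2) by blast
      have nJ'J: "normalizes J' J"
        by (rule prime_index_normal[OF J(2) J(1) JJ' cJ' N(1) NJ nJN t(1) cJN])
      obtain f where f: "mod_character t J' f" "char_kernel t J' f = J"
        using character_of_prime_index[OF J(2,1) JJ' nJ'J t(1) cJ'] by blast
      have PL: "normalizes P L" using normalizes_mono[OF L(3) PA] .
      have PNK: "P \<subseteq> ?NK" "P \<subseteq> ?NK'"
        using K(2) set_mult_upper2[OF N(1) subgroup.subset[OF K(1)]] NKsub by blast+
      have PJ: "normalizes P J" unfolding J_def
        using normalizes_Int[OF PL normalizes_mono[OF normalizes_self[OF s(1)] PNK(1)]] .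
      have PJ': "normalizes P J'" unfolding J'_def
        using normalizes_Int[OF PL normalizes_mono[OF normalizes_self[OF s(2)] PNK(2)]] .
      have nx: "normalizes {x} J" "normalizes {x} J'" if "x \<in> P" for x
        using that normalizes_mono[OF PJ] normalizes_mono[OF PJ'] by auto
      have ev: "\<exists>k. \<forall>g\<in>J'. [f (conj_by x g) = k * f g] (mod int t)" if x: "x \<in> P" for x
        using eigen_of_normalizes_kernel[OF J(2) f(1) t(1) Pc[OF x] nx(2)[OF x]] f(2) nx(1)[OF x] by simp
      have zf: "[f (conj_by z g) = f g] (mod int t)" if g: "g \<in> J'" for g
        using z
      proof (elim disjE bexE)
        fix x assume x: "x \<in> P" "z = x [^] (t - 1)"
        obtain k where k: "\<And>g. g \<in> J' \<Longrightarrow> [f (conj_by x g) = k * f g] (mod int t)" using ev[OF x(1)] by blast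
        show ?thesis unfolding x(2)
          using eigen_pow[OF J(2) f(1) t(1) Pc[OF x(1)] nx(2)[OF x(1)] k g] .
      next
        fix x y assume xy: "x \<in> P" "y \<in> P" "z = commutator x y"
        obtain k l where k: "\<And>g. g \<in> J' \<Longrightarrow> [f (conj_by x g) = k * f g] (mod int t)"
          and l: "\<And>g. g \<in> J' \<Longrightarrow> [f (conj_by y g) = l * f g] (mod int t)" using ev[OF xy(1)] ev[OF xy(2)] by blast
        have xJ: "conj_by x g \<in> J'" "conj_by y g \<in> J'" if "g \<in> J'" for g using that normalizesD[OF PJ'] xy by blast+
        have "[f (conj_by x (conj_by y g)) = f (conj_by y (conj_by x g))] (mod int t)" if g: "g \<in> J'" for g
        proof -
          have "[f (conj_by x (conj_by y g)) = k * (l * f g)] (mod int t)"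
            using cong_trans[OF k[OF xJ(2)[OF g]] cong_scalar_left[OF l[OF g]]] .
          moreover have "[f (conj_by y (conj_by x g)) = l * (k * f g)] (mod int t)"
            using cong_trans[OF l[OF xJ(1)[OF g]] cong_scalar_left[OF k[OF g]]] .
          moreover have "k * (l * f g) = l * (k * f g)" by simp
          ultimately show ?thesis using cong_sym cong_trans by metis
        qed
        then show ?thesis unfolding xy(3)
          using commuting_values[OF J(2) Pc[OF xy(1)] nx(2)[OF xy(1)] Pc[OF xy(2)] nx(2)[OF xy(2)] _ g] by blast
      qed
      have zJ: "commutator z h \<in> J" if h: "h \<in> J'" for h
      proof -
        have zh: "conj_by z h \<in> J'" using normalizesD[OF PJ' zP h] .
        have "int t dvd f (commutator z h)" using mod_character_div_iff[OF J(2) f(1) zh h] zf[OF h] by blast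
        moreover have "commutator z h \<in> J'" by (rule subgroup.m_closed[OF J(2) zh subgroup.m_inv_closed[OF J(2) h]])
        ultimately have "commutator z h \<in> char_kernel t J' f" by (simp add: char_kernel_def)
        then show ?thesis using f(2) by simp
      qed
      have "commutator z h \<in> N" if h: "h \<in> J'" for h
        using trivial_action_lift[OF J(2,1) JJ' N(1) NJ nJN P(1) PJ' nK[OF PA] P(2) q t _ zP zJ _ h] y j IH by blast
      then show ?thesis by (simp add: J'_def)
    qed
  qed
  have "L \<subseteq> N <#> A" using L(2) set_mult_upper2[OF N(1) subgroup.subset[OF A]] by blast
  then show ?thesis using key[OF P(3)] g by blast
qed

lemma maximal_of_prime_index:
  assumes T: "subgroup T G" and M: "subgroup M G" "M \<subseteq> T" and t: "prime t" and c: "card T = t * card M"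
  shows "maximal_subgroup M (G\<lparr>carrier := T\<rparr>)"
  unfolding maximal_subgroup_def
proof (intro conjI allI impI)
  show "subgroup M (G\<lparr>carrier := T\<rparr>)" using subgroup_incl[OF M(1) T M(2)] .
  show "M \<noteq> carrier (G\<lparr>carrier := T\<rparr>)"
  proof
    assume "M = carrier (G\<lparr>carrier := T\<rparr>)"
    then have "t = 1" using c card_pos[OF T] by simp
    then show False using t by simp
  qed
  fix K assume K: "subgroup K (G\<lparr>carrier := T\<rparr>) \<and> M \<subseteq> K"
  then have K': "subgroup K G" "K \<subseteq> T" "M \<subseteq> K"
    using incl_subgroup[OF T] subgroup.subset by fastforce+
  obtain x where x: "card K = x * card M" using card_dvd[OF M(1) K'(1,3)] by (metis dvd_div_mult_self)
  obtain y where y: "card T = y * card K" using card_dvd[OF K'(1) T K'(2)] by (metis dvd_div_mult_self)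
  have "t = y * x" using c x y card_pos[OF M(1)] by (metis mult.assoc mult_right_cancel less_not_refl)
  then have "x = 1 \<or> y = 1" using t prime_product by blast
  then show "K = M \<or> K = carrier (G\<lparr>carrier := T\<rparr>)"
    using x y card_subset_eq[OF sub_finite[OF K'(1)] K'(3)] card_subset_eq[OF sub_finite[OF T] K'(2)] by auto
qed

text \<open>
  The kernel of \<open>f\<close> is \<open>N\<close> times its intersection with \<open>T\<close>, and this intersection is either \<open>T\<close> or a maximal
  subgroup of \<open>T\<close>.  In the first case the kernel is everything, whether or not \<open>b\<close> normalizes \<open>T\<close>.
\<close>

lemma eigen_of_normalizes_maximal:
  assumes N: "subgroup N G" and T: "subgroup T G" "normalizes T N" and t: "prime t"
    and cop: "coprime t (card N)"
    and b: "b \<in> carrier G" "normalizes {b} N" "normalizes {b} (N <#> T)"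
    and max: "\<And>M m. maximal_subgroup M (G\<lparr>carrier := T\<rparr>) \<Longrightarrow> m \<in> M \<Longrightarrow> conj_by b m \<in> M"
    and f: "mod_character t (N <#> T) f"
  shows "\<exists>k. \<forall>g\<in>N <#> T. [f (conj_by b g) = k * f g] (mod int t)"
proof -
  let ?L = "N <#> T"
  have L: "subgroup ?L G" using subgroup_set_mult[OF N T] .
  have NL: "N \<subseteq> ?L" "T \<subseteq> ?L"
    using set_mult_upper1[OF T(1) subgroup.subset[OF N]] set_mult_upper2[OF N subgroup.subset[OF T(1)]] by auto
  define K where "K = char_kernel t ?L f"
  have K: "subgroup K G" unfolding K_def by (rule char_kernel_subgroup[OF L f])
  have NK: "N \<subseteq> K"
    using mod_character_trivial_on_coprime[OF L f N cop] NL by (auto simp: K_def char_kernel_def)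
  have fT: "mod_character t T f" using f NL(2) unfolding mod_character_def by blast
  have TK: "char_kernel t T f = T \<inter> K" using NL(2) by (auto simp: K_def char_kernel_def)
  have bTK: "conj_by b m \<in> K" if m: "m \<in> T \<inter> K" for m
  proof (cases "\<exists>g\<in>T. \<not> int t dvd f g")
    case True
    have "maximal_subgroup (char_kernel t T f) (G\<lparr>carrier := T\<rparr>)"
      using maximal_of_prime_index[OF T(1) char_kernel_subgroup[OF T(1) fT] _ t card_char_kernel[OF T(1) fT t True]]
      by (auto simp: char_kernel_def)
    then show ?thesis using max m TK by blast
  next
    case False
    then have "T \<subseteq> K" using NL(2) by (auto simp: K_def char_kernel_def)
    then have "?L \<subseteq> K" using set_mult_least[OF K NK] by blast
    then show ?thesis using m NL(2) normalizesD[OF b(3)] by blast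
  qed
  have "normalizes {b} K"
    unfolding normalizes_def
  proof (intro ballI)
    fix x g assume x: "x \<in> {b}" and g: "g \<in> K"
    then have "g \<in> ?L" by (auto simp: K_def char_kernel_def)
    then obtain n s where ns: "n \<in> N" "s \<in> T" "g = n \<otimes> s" by (auto simp: set_mult_def)
    have c: "n \<in> carrier G" "s \<in> carrier G" using ns sub_carrier[OF N] sub_carrier[OF T(1)] by blast+
    have "inv n \<otimes> g \<in> K"
      by (rule subgroup.m_closed[OF K subgroup.m_inv_closed[OF K subsetD[OF NK ns(1)]] g])
    then have "s \<in> K" using ns(3) c by simp
    then have "conj_by b s \<in> K" using bTK ns by blast
    moreover have "conj_by b n \<in> K" using normalizesD[OF b(2)] ns(1) NK by blast
    ultimately have "conj_by b n \<otimes> conj_by b s \<in> K" using subgroup.m_closed[OF K] by blast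
    then show "conj_by x g \<in> K" using x ns(3) c b(1) by (simp add: conj_by_mult)
  qed
  then show ?thesis
    using eigen_of_normalizes_kernel[OF L f t b(1,3)] by (simp add: K_def)
qed

section \<open>The weak direct product\<close>

lemma sylow_in_subgroup:
  assumes A: "subgroup A G" and p: "prime p"
  shows "\<exists>T. subgroup T G \<and> T \<subseteq> A \<and> card T = p ^ multiplicity p (card A)"
proof -
  have g: "group (G\<lparr>carrier := A\<rparr>)" using A by (rule subgroup_imp_group)
  have "Coset.order (G\<lparr>carrier := A\<rparr>) = p ^ multiplicity p (card A) * (card A div p ^ multiplicity p (card A))"
    by (simp add: Coset.order_def multiplicity_dvd)
  then obtain T where T: "subgroup T (G\<lparr>carrier := A\<rparr>)" "card T = p ^ multiplicity p (card A)"
    using sylow_thm[OF p g] sub_finite[OF A] by auto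
  then show ?thesis using incl_subgroup[OF A T(1)] subgroup.subset[OF T(1)] by auto
qed

lemma set_mult_subgroup_absorb:
  assumes "subgroup K G" "subgroup H G" "H \<subseteq> K"
  shows "K <#> H = K" "H <#> K = K"
  using set_mult_least[OF assms(1) subset_refl assms(3)] set_mult_least[OF assms(1,3) subset_refl]
    set_mult_upper1[OF assms(2) subgroup.subset[OF assms(1)]]
    set_mult_upper2[OF assms(2) subgroup.subset[OF assms(1)]] by blast+

text \<open>
  Conjugation by \<open>x \<in> Q\<close> permutes the characters, so a scalar \<open>k\<close> that is the same for all of them
  commutes with it.
\<close>

lemma trivial_of_uniform_eigenvalue:
  assumes L: "subgroup L G" and N: "subgroup N G" "N \<subseteq> L" "normalizes L N"
    and Q: "subgroup Q G" "normalizes Q L" "normalizes Q N" "card Q = q ^ n"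
    and q: "prime q" and t: "prime t" "t \<noteq> q" and cL: "card L = t ^ m * card N"
    and b: "b \<in> Q"
    and k: "\<And>f g. mod_character t L f \<Longrightarrow> g \<in> L \<Longrightarrow> [f (conj_by b g) = k * f g] (mod int t)"
    and g: "g \<in> L"
  shows "commutator (b [^] (t - 1)) g \<in> N"
    and "x \<in> Q \<Longrightarrow> commutator (commutator b x) g \<in> N"
    and "x \<in> Q \<Longrightarrow> commutator (commutator x b) g \<in> N"
proof -
  have Qc: "x \<in> carrier G" if "x \<in> Q" for x using that sub_carrier[OF Q(1)] by blast
  have nx: "normalizes {x} L" if "x \<in> Q" for x using that normalizes_mono[OF Q(2)] by blast
  note trivial = trivial_of_trivial_on_characters[OF L N Q q t cL _ _ g]
  show "commutator (b [^] (t - 1)) g \<in> N"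
  proof (rule trivial)
    show "b [^] (t - 1) \<in> Q" using pow_mem[OF Q(1) b] .
    show "[f (conj_by (b [^] (t - 1)) h) = f h] (mod int t)" if "mod_character t L f" "h \<in> L" for f h
      using eigen_pow[OF L that(1) t(1) Qc[OF b] nx[OF b] k[OF that(1)] that(2)] .
  qed
  have com: "[f (conj_by x (conj_by b h)) = f (conj_by b (conj_by x h))] (mod int t)"
    if x: "x \<in> Q" and f: "mod_character t L f" and h: "h \<in> L" for f x h
  proof -
    have xL: "conj_by x h \<in> L" if "h \<in> L" for h using normalizesD[OF Q(2) x that] .
    have "mod_character t L (\<lambda>g. f (conj_by x g))"
      unfolding mod_character_def
    proof (intro ballI)
      fix u v assume "u \<in> L" "v \<in> L"
      then show "[f (conj_by x (u \<otimes> v)) = f (conj_by x u) + f (conj_by x v)] (mod int t)"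
        using mod_character_mult[OF L f xL xL] Qc[OF x] sub_carrier[OF L] by (simp add: conj_by_mult)
    qed
    then have "[f (conj_by x (conj_by b h)) = k * f (conj_by x h)] (mod int t)" using k h by blast
    moreover have "[f (conj_by b (conj_by x h)) = k * f (conj_by x h)] (mod int t)" using k[OF f xL[OF h]] .
    ultimately show ?thesis using cong_sym cong_trans by blast
  qed
  have comQ: "commutator u v \<in> Q" if "u \<in> Q" "v \<in> Q" for u v
    by (rule subgroup.m_closed[OF Q(1) normalizesD[OF normalizes_self[OF Q(1)] that]
      subgroup.m_inv_closed[OF Q(1) that(2)]])
  show "commutator (commutator b x) g \<in> N" if x: "x \<in> Q"
  proof (rule trivial[OF comQ[OF b x]])
    show "[f (conj_by (commutator b x) h) = f h] (mod int t)" if "mod_character t L f" "h \<in> L" for f h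
      using commuting_values[OF L Qc[OF b] nx[OF b] Qc[OF x] nx[OF x] _ that(2)]
        com[OF x that(1)] cong_sym by blast
  qed
  show "commutator (commutator x b) g \<in> N" if x: "x \<in> Q"
  proof (rule trivial[OF comQ[OF x b]])
    show "[f (conj_by (commutator x b) h) = f h] (mod int t)" if "mod_character t L f" "h \<in> L" for f h
      using commuting_values[OF L Qc[OF x] nx[OF x] Qc[OF b] nx[OF b] _ that(2)]
        com[OF x that(1)] by blast
  qed
qed

text \<open>
  Descending induction through the Sylow tower of \<open>A\<close>: starting above all primes, where the Hall subgroup is
  trivial, a chain from \<open>Q\<close> to \<open>L Q\<close> is prolonged whenever \<open>t\<close> is a prime different from \<open>q\<close>.
\<close>

lemma prime_chain_to_product:
  assumes A: "subgroup A G" and Q: "subgroup Q G" "card Q = q ^ n" "normalizes Q A" and q: "prime q"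
    and P: "card (Q \<inter> A) = q ^ multiplicity q (card A)"
    and B: "subgroup B G" "B \<subseteq> Q" "Q = (Q \<inter> A) <#> B"
    and ws: "\<And>p T. prime p \<Longrightarrow> subgroup T G \<Longrightarrow> T \<subseteq> A \<Longrightarrow> card T = p ^ multiplicity p (card A) \<Longrightarrow>
        prime_chain T A"
    and max: "\<And>p T M b m. prime p \<Longrightarrow> subgroup T G \<Longrightarrow> T \<subseteq> A \<Longrightarrow> card T = p ^ multiplicity p (card A) \<Longrightarrow>
        maximal_subgroup M (G\<lparr>carrier := T\<rparr>) \<Longrightarrow> b \<in> B \<Longrightarrow> m \<in> M \<Longrightarrow> conj_by b m \<in> M"
  shows "prime_chain Q (A <#> Q)"
proof -
  define P where "P = Q \<inter> A"
  have sP: "subgroup P G" unfolding P_def using subgroup_Int[OF Q(1) A] .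
  have PA: "P \<subseteq> A" "P \<subseteq> Q" by (auto simp: P_def)
  have cP: "card P = q ^ multiplicity q (card A)" using P by (simp add: P_def)
  have chainP: "prime_chain P A" using ws[OF q sP PA(1) cP] .
  have Qc: "x \<in> carrier G" if "x \<in> Q" for x using that sub_carrier[OF Q(1)] by blast
  have gen: "normalizes Q H" if H: "subgroup H G" "normalizes (P \<union> B) H" for H
    using set_mult_normalizes[OF sP B(1) H(1)] normalizes_mono[OF H(2)] B(3) by (simp add: P_def)
  have "\<exists>L. upper_hall i A L \<and> prime_chain Q (L <#> Q)" if "i \<le> Suc (card A)" for i
    using that
  proof (induction rule: inc_induct)
    case base
    have "upper_hall (Suc (card A)) A {\<one>}"
      unfolding upper_hall_def
    proof (intro conjI allI impI)
      show "subgroup {\<one>} G" by (rule triv_subgroup)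
      show "{\<one>} \<subseteq> A" using subgroup.one_closed[OF A] by blast
      show "normalizes A {\<one>}" using sub_carrier[OF A] by (simp add: normalizes_def)
      show "p < Suc (card A)" if "prime p \<and> p dvd card A div card {\<one>}" for p
        using that dvd_imp_le[of p "card A"] card_pos[OF A] by simp
    qed auto
    moreover have "{\<one>} <#> Q = Q"
      using set_mult_subgroup_absorb(2)[OF Q(1) triv_subgroup] subgroup.one_closed[OF Q(1)] by simp
    ultimately show ?case using prime_chain.base[OF Q(1)] by metis
  next
    case (step t)
    then obtain N where N: "upper_hall (Suc t) A N" "prime_chain Q (N <#> Q)" by blast
    note h = upper_hallD[OF N(1)]
    show ?case
    proof (cases "prime t")
      case False
      have "p < t" if "prime p" "p dvd card A div card N" for p
        using h(5)[OF that] that(1) False less_SucE by blast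
      then have "upper_hall t A N"
        using N(1) Suc_leD unfolding upper_hall_def by blast
      then show ?thesis using N(2) by blast
    next
      case t: True
      show ?thesis
      proof (cases "t = q")
        case True
        have "upper_hall t A (N <#> P)"
          using upper_hall_step(1)[OF A t N(1) sP _ chainP] cP True by simp
        moreover have "(N <#> P) <#> Q = N <#> Q"
          using set_mult_assoc[OF subgroup.subset[OF h(1)] subgroup.subset[OF sP] subgroup.subset[OF Q(1)]]
            set_mult_subgroup_absorb(2)[OF Q(1) sP PA(2)] by simp
        ultimately show ?thesis using N(2) by metis
      next
        case tq: False
        obtain T where T: "subgroup T G" "T \<subseteq> A" "card T = t ^ multiplicity t (card A)"
          using sylow_in_subgroup[OF A t] by blast
        define L where "L = N <#> T"
        define m where "m = multiplicity t (card A)"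
        have L: "upper_hall t A L" "card L = t ^ m * card N"
          using upper_hall_step[OF A t N(1) T(1,3) ws[OF t T]] by (simp_all add: L_def m_def)
        note hL = upper_hallD[OF L(1)]
        have NL: "N \<subseteq> L" unfolding L_def using set_mult_upper1[OF T(1) subgroup.subset[OF h(1)]] .
        have nLN: "normalizes L N" using normalizes_mono[OF h(3) hL(2)] .
        have "\<not> t dvd card N" using h(4)[OF t] by auto
        then have cop: "coprime t (card N)" using t by (rule prime_imp_coprime[rotated])
        have Qsub: "Q \<subseteq> carrier G" by (rule subgroup.subset[OF Q(1)])
        have QN: "normalizes Q N" "normalizes Q L"
          using upper_hall_invariant[OF A N(1) Qsub Q(3)] upper_hall_invariant[OF A L(1) Qsub Q(3)] by auto
        have uni: "\<exists>k. \<forall>f g. mod_character t L f \<longrightarrow> g \<in> L \<longrightarrow> [f (conj_by b g) = k * f g] (mod int t)"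
          if b: "b \<in> B" for b
        proof -
          have bQ: "b \<in> Q" using b B(2) by blast
          have nb: "normalizes {b} L" "normalizes {b} N" using normalizes_mono[OF QN(2)] normalizes_mono[OF QN(1)] bQ by blast+
          have "\<exists>k. \<forall>g\<in>L. [f (conj_by b g) = k * f g] (mod int t)" if f: "mod_character t L f" for f
            unfolding L_def
          proof (rule eigen_of_normalizes_maximal[OF h(1) T(1) normalizes_mono[OF h(3) T(2)] t cop Qc[OF bQ] nb(2)])
            show "normalizes {b} (N <#> T)" using nb(1) by (simp add: L_def)
            show "conj_by b m \<in> M" if "maximal_subgroup M (G\<lparr>carrier := T\<rparr>)" "m \<in> M" for M m
              using max[OF t T that(1) b that(2)] .
            show "mod_character t (N <#> T) f" using f by (simp add: L_def)
          qed
          then show ?thesis using uniform_eigenvalue[OF hL(1) t nb(1)] by blast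
        qed
        have Btriv: "commutator (b [^] (t - 1)) g \<in> N"
            "x \<in> Q \<Longrightarrow> commutator (commutator b x) g \<in> N"
            "x \<in> Q \<Longrightarrow> commutator (commutator x b) g \<in> N"
          if b: "b \<in> B" and g: "g \<in> L" for b g x
        proof -
          obtain k where k: "\<And>f g. mod_character t L f \<Longrightarrow> g \<in> L \<Longrightarrow> [f (conj_by b g) = k * f g] (mod int t)"
            using uni[OF b] by blast
          have bQ: "b \<in> Q" using b B(2) by blast
          note tr = trivial_of_uniform_eigenvalue[OF hL(1) h(1) NL nLN Q(1) QN(2,1) Q(2) q t tq L(2) bQ k g]
          show "commutator (b [^] (t - 1)) g \<in> N" by (rule tr(1))
          show "x \<in> Q \<Longrightarrow> commutator (commutator b x) g \<in> N" by (rule tr(2))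
          show "x \<in> Q \<Longrightarrow> commutator (commutator x b) g \<in> N" by (rule tr(3))
        qed
        have Ptriv: "commutator z g \<in> N"
          if "(\<exists>x\<in>P. z = x [^] (t - 1)) \<or> (\<exists>x\<in>P. \<exists>y\<in>P. z = commutator x y)" "g \<in> L" for z g
          using sylow_commutators_trivial[OF A sP cP chainP q t tq h(1,2,3) hL(1,2,3) NL L(2) cop that] .
        have "prime_chain (N <#> Q) (L <#> Q)"
        proof (rule prime_chain_of_commuting_action[OF h(1) cop Q(1,2) QN(1) q t tq _ gen hL(1) NL nLN QN(2) L(2)])
          show "P \<union> B \<subseteq> Q" using PA(2) B(2) by blast
          show "commutator (x [^] (t - 1)) g \<in> N" if "x \<in> P \<union> B" "g \<in> L" for x g
            using that Btriv(1) Ptriv by blast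
          show "commutator (commutator x y) g \<in> N" if xy: "x \<in> P \<union> B" "y \<in> P \<union> B" and g: "g \<in> L" for x y g
          proof -
            have "x \<in> Q" "y \<in> Q" using xy PA(2) B(2) by blast+
            then show ?thesis using xy g Btriv(2,3) Ptriv by blast
          qed
        qed
        then have "prime_chain Q (L <#> Q)" using prime_chain_trans N(2) by blast
        then show ?thesis using L(1) by blast
      qed
    qed
  qed
  from this[of 0] obtain L where L: "upper_hall 0 A L" "prime_chain Q (L <#> Q)" by blast
  note h = upper_hallD[OF L(1)]
  have "card A div card L = 1"
  proof (rule ccontr)
    assume "card A div card L \<noteq> 1"
    then obtain p where "prime p" "p dvd card A div card L" using prime_factor_nat by blast
    then show False using h(5) by blast
  qed
  moreover have "card L dvd card A" using card_dvd[OF h(1) A h(2)] .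
  ultimately have "card L = card A" by (metis dvd_div_mult_self mult_1)
  then have "L = A" using card_subset_eq[OF sub_finite[OF A] h(2)] by simp
  then show ?thesis using L(2) by simp
qed

end

theorem corollaryA:
  fixes G :: "('a, 'b) monoid_scheme" and A B :: "'a set"
  assumes "group G" and "finite (carrier G)"
    and "weak_direct_product G A B"
    and "w_supersoluble (G\<lparr>carrier := A\<rparr>)"
    and "w_supersoluble (G\<lparr>carrier := B\<rparr>)"
  shows "w_supersoluble G"
proof -
  interpret finite_group G using assms(1,2) by (simp add: finite_group_def finite_group_axioms_def)
  have AB: "subgroup A G" "subgroup B G" "carrier G = A <#>\<^bsub>G\<^esub> B" "A \<lhd> G" "A \<inter> B = {\<one>\<^bsub>G\<^esub>}"
    using assms(3) by (simp_all add: weak_direct_product_def weak_normal_product_def)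
  have perm: "permuting G B M"
    if "sylow_subgroup p T (G\<lparr>carrier := A\<rparr>)" "maximal_subgroup M (G\<lparr>carrier := T\<rparr>)" for p T M
    using assms(3) that unfolding weak_direct_product_def weak_normal_product_def by blast
  have nA: "normalizes (carrier G) A"
    using AB(4) unfolding normal_inv_iff by (simp add: normalizes_def conj_by_def)
  have syl: "sylow_subgroup p T (G\<lparr>carrier := H\<rparr>)"
    if "prime p" "subgroup T G" "T \<subseteq> H" "subgroup H G" "card T = p ^ multiplicity p (card H)" for p T H
    using that subgroup_incl by (simp add: sylow_subgroup_def Coset.order_def)
  have ws: "prime_chain T H"
    if "subgroup H G" "w_supersoluble (G\<lparr>carrier := H\<rparr>)" "prime p" "subgroup T G" "T \<subseteq> H"
      "card T = p ^ multiplicity p (card H)" for p T H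
    using that syl prime_chain_of_P_subnormal unfolding w_supersoluble_def by blast
  have max: "conj_by b m \<in> M"
    if T: "prime p" "subgroup T G" "T \<subseteq> A" "card T = p ^ multiplicity p (card A)"
      and M: "maximal_subgroup M (G\<lparr>carrier := T\<rparr>)" and bm: "b \<in> B" "m \<in> M" for p T M b m
  proof -
    have sM: "subgroup M G" "M \<subseteq> A"
      using M incl_subgroup[OF T(2)] subgroup.subset[of M "G\<lparr>carrier := T\<rparr>"] T(3)
      by (auto simp: maximal_subgroup_def)
    have "b \<otimes>\<^bsub>G\<^esub> m \<in> M <#>\<^bsub>G\<^esub> B"
      using perm[OF syl[OF T(1-3) AB(1) T(4)] M] bm mem_set_multI unfolding permuting_def by metis
    then obtain m' b' where e: "m' \<in> M" "b' \<in> B" "b \<otimes>\<^bsub>G\<^esub> m = m' \<otimes>\<^bsub>G\<^esub> b'" by (auto simp: set_mult_def)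
    have c: "b \<in> carrier G" "b' \<in> carrier G" "m \<in> carrier G" "m' \<in> carrier G"
      using bm e sub_carrier[OF AB(2)] sub_carrier[OF sM(1)] by blast+
    have eq: "conj_by b m = m' \<otimes>\<^bsub>G\<^esub> (b' \<otimes>\<^bsub>G\<^esub> inv\<^bsub>G\<^esub> b)" using e(3) c by (simp add: conj_by_def m_assoc)
    have "conj_by b m \<in> A" using normalizesD[OF nA c(1)] bm sM by blast
    moreover have "inv\<^bsub>G\<^esub> m' \<in> A" using subgroup.m_inv_closed[OF AB(1)] e sM by blast
    ultimately have "inv\<^bsub>G\<^esub> m' \<otimes>\<^bsub>G\<^esub> conj_by b m \<in> A" using subgroup.m_closed[OF AB(1)] by blast
    moreover have "inv\<^bsub>G\<^esub> m' \<otimes>\<^bsub>G\<^esub> conj_by b m = b' \<otimes>\<^bsub>G\<^esub> inv\<^bsub>G\<^esub> b" unfolding eq using c by simp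
    moreover have "b' \<otimes>\<^bsub>G\<^esub> inv\<^bsub>G\<^esub> b \<in> B"
      by (rule subgroup.m_closed[OF AB(2) e(2) subgroup.m_inv_closed[OF AB(2) bm(1)]])
    ultimately have "b' \<otimes>\<^bsub>G\<^esub> inv\<^bsub>G\<^esub> b = \<one>\<^bsub>G\<^esub>" using AB(5) by auto
    then show ?thesis using eq e(1) c by simp
  qed
  have G: "subgroup (carrier G) G" by (rule subgroup_self)
  have cG: "card (carrier G) = card A * card B"
    using card_set_mult[OF AB(1,2)] AB(3,5) by simp
  have "P_subnormal Q1 G" if Q1: "sylow_subgroup q Q1 G" for q Q1
  proof -
    have q: "prime q" and sQ1: "subgroup Q1 G" using Q1 by (auto simp: sylow_subgroup_def)
    define i where "i = multiplicity q (card A)"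
    define j where "j = multiplicity q (card B)"
    have mG: "multiplicity q (card (carrier G)) = i + j"
      unfolding cG i_def j_def using q card_pos[OF AB(1)] card_pos[OF AB(2)]
      by (simp add: prime_elem_multiplicity_mult_distrib)
    then have cQ1: "card Q1 = q ^ (i + j)" using Q1 by (simp add: sylow_subgroup_def Coset.order_def)
    obtain Bq where Bq: "subgroup Bq G" "Bq \<subseteq> B" "card Bq = q ^ j"
      using sylow_in_subgroup[OF AB(2) q] by (auto simp: j_def)
    obtain c where c: "card (carrier G) = c * card Q1"
      using card_dvd[OF sQ1 G subgroup.subset[OF sQ1]] by (metis dvd_div_mult_self)
    have "\<not> q dvd c"
    proof
      assume "q dvd c"
      then have "q ^ Suc (i + j) dvd card (carrier G)" unfolding c cQ1 by auto
      then have "Suc (i + j) \<le> i + j" unfolding mG[symmetric]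
        using q card_pos[OF G] by (intro multiplicity_geI) auto
      then show False by simp
    qed
    then obtain g where g: "g \<in> carrier G" "\<And>u. u \<in> Bq \<Longrightarrow> conj_by g u \<in> Q1"
      using conjugate_into_sylow[OF G Bq(1) subgroup.subset[OF Bq(1)] sQ1 subgroup.subset[OF sQ1] q Bq(3) c] by blast
    define Q where "Q = conj_by (inv\<^bsub>G\<^esub> g) ` Q1"
    have Q: "subgroup Q G" "card Q = q ^ (i + j)"
      unfolding Q_def using conj_by_subgroup card_conj_by g sQ1 cQ1 by simp_all
    have BQ: "Bq \<subseteq> Q"
    proof
      fix u assume u: "u \<in> Bq"
      then have "u = conj_by (inv\<^bsub>G\<^esub> g) (conj_by g u)" using g sub_carrier[OF Bq(1)] by simp
      then show "u \<in> Q" unfolding Q_def using g(2)[OF u] by blast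
    qed
    have nQ: "normalizes Q A" using normalizes_mono[OF nA subgroup.subset[OF Q(1)]] .
    have sAQ: "subgroup (A <#>\<^bsub>G\<^esub> Q) G" using subgroup_set_mult[OF AB(1) Q(1) nQ] .
    have sI: "subgroup (A \<inter> Q) G" using subgroup_Int[OF AB(1) Q(1)] .
    \<comment> \<open>The index \<open>d\<close> of \<open>A\<close> in \<open>A Q\<close> divides \<open>|G : A| = |B|\<close>, so neither factor of \<open>|Q|\<close> can exceed its share.\<close>
    have cI: "card (A \<inter> Q) = q ^ i"
    proof -
      obtain d where d: "card (A <#>\<^bsub>G\<^esub> Q) = d * card A"
        using card_dvd[OF AB(1) sAQ set_mult_upper1[OF Q(1) subgroup.subset[OF AB(1)]]] by (metis dvd_div_mult_self)
      have "d * card (A \<inter> Q) * card A = card Q * card A" using card_set_mult[OF AB(1) Q(1)] d by (simp add: mult_ac)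
      then have dI: "d * card (A \<inter> Q) = q ^ (i + j)" using card_pos[OF AB(1)] Q(2) by simp
      then have "d dvd q ^ (i + j)" "card (A \<inter> Q) dvd q ^ (i + j)" by (metis dvd_triv_left dvd_triv_right)+
      then obtain k l where kl: "d = q ^ k" "card (A \<inter> Q) = q ^ l" using q divides_primepow_nat by metis
      have "q ^ (k + l) = q ^ (i + j)" using dI kl by (simp add: power_add)
      then have s: "k + l = i + j" using prime_gt_1_nat[OF q] power_inject_exp by blast
      have "card (A <#>\<^bsub>G\<^esub> Q) dvd card B * card A"
        using card_dvd[OF sAQ G subgroup.subset[OF sAQ]] cG by (simp add: mult.commute)
      then have "q ^ k dvd card B" using d kl card_pos[OF AB(1)] by simp
      then have "k \<le> j" unfolding j_def using q card_pos[OF AB(2)] by (intro multiplicity_geI) auto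
      moreover have "q ^ l dvd card A" using card_dvd[OF sI AB(1)] kl by auto
      then have "l \<le> i" unfolding i_def using q card_pos[OF AB(1)] by (intro multiplicity_geI) auto
      ultimately have "l = i" using s by linarith
      then show ?thesis using kl by simp
    qed
    have QP: "Q = (Q \<inter> A) <#>\<^bsub>G\<^esub> Bq"
    proof -
      have "(Q \<inter> A) \<inter> Bq = {\<one>\<^bsub>G\<^esub>}"
        using AB(5) Bq(2) subgroup.one_closed[OF subgroup_Int[OF sI Bq(1)]] by blast
      then have "card ((Q \<inter> A) <#>\<^bsub>G\<^esub> Bq) = q ^ (i + j)"
        using card_set_mult[OF sI Bq(1)] cI Bq(3) by (simp add: Int_commute power_add)
      moreover have "(Q \<inter> A) <#>\<^bsub>G\<^esub> Bq \<subseteq> Q" using set_mult_least[OF Q(1) _ BQ] by blast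
      ultimately show ?thesis using card_subset_eq[OF sub_finite[OF Q(1)]] Q(2) by metis
    qed
    have "prime_chain Q (A <#>\<^bsub>G\<^esub> Q)"
    proof (rule prime_chain_to_product[OF AB(1) Q nQ q _ Bq(1) BQ QP])
      show "card (Q \<inter> A) = q ^ multiplicity q (card A)" using cI by (simp add: i_def Int_commute)
      show "prime_chain T A" if "prime p" "subgroup T G" "T \<subseteq> A" "card T = p ^ multiplicity p (card A)" for p T
        using ws[OF AB(1) assms(4) that] .
      show "conj_by b m \<in> M" if "prime p" "subgroup T G" "T \<subseteq> A" "card T = p ^ multiplicity p (card A)"
        "maximal_subgroup M (G\<lparr>carrier := T\<rparr>)" "b \<in> Bq" "m \<in> M" for p T M b m
        using max[OF that(1-5) _ that(7)] that(6) Bq(2) by blast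
    qed
    moreover have "A <#>\<^bsub>G\<^esub> Q = A <#>\<^bsub>G\<^esub> Bq"
    proof -
      have "A <#>\<^bsub>G\<^esub> Q = A <#>\<^bsub>G\<^esub> ((Q \<inter> A) <#>\<^bsub>G\<^esub> Bq)" using QP by simp
      also have "\<dots> = (A <#>\<^bsub>G\<^esub> (Q \<inter> A)) <#>\<^bsub>G\<^esub> Bq"
        using set_mult_assoc[OF subgroup.subset[OF AB(1)] subgroup.subset[OF sI] subgroup.subset[OF Bq(1)]]
        by (simp add: Int_commute)
      also have "A <#>\<^bsub>G\<^esub> (Q \<inter> A) = A"
        using set_mult_subgroup_absorb(1)[OF AB(1) sI] by (simp add: Int_commute)
      finally show ?thesis .
    qed
    moreover have "prime_chain (A <#>\<^bsub>G\<^esub> Bq) (A <#>\<^bsub>G\<^esub> B)"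
    proof (rule prime_chain_set_mult[OF AB(1)])
      show "prime_chain Bq B" using ws[OF AB(2) assms(5) q Bq(1,2)] Bq(3) by (simp add: j_def)
      show "normalizes B A" using normalizes_mono[OF nA subgroup.subset[OF AB(2)]] .
    qed
    ultimately have "prime_chain Q (carrier G)" using prime_chain_trans AB(3) by metis
    then have "prime_chain (conj_by g ` Q) (conj_by g ` carrier G)" by (rule prime_chain_conj[OF g(1)])
    moreover have "conj_by g ` Q = Q1"
      unfolding Q_def image_image using g(1) sub_carrier[OF sQ1] by simp
    moreover have "conj_by g ` carrier G = carrier G" using conj_by_image_eq[OF g(1) G] g(1) by simp
    ultimately show ?thesis using P_subnormal_of_prime_chain by simp
  qed
  then show ?thesis using assms(1,2) by (simp add: w_supersoluble_def)
qed

end
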